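(* Let $p\ge 2$, $p'=p/(p-1)$, let $V\in L^\infty_{\mathrm{loc}}(\mathbb{R}^n)$ with $V\ge1$ a.e., and let $f\in L^1(\mathbb{R}^n)$. Let $u\in\Lambda^p(\mathbb{R}^n)$ be an asymptotic energy solution of $-\operatorname{div}(|\nabla u|^{p-2}\nabla u)+V|u|^{p-2}u=f$ in $\mathbb{R}^n$, and let $\{u_j\}_{j\in\mathbb{N}}\subseteq\mathrm{X}$ be an approximate sequence for $u$, with corresponding data $\{f_j\}\subseteq L^1(\mathbb{R}^n)\cap L^{p'}(\mathbb{R}^n)$. Assume in addition that for every $\alpha>0$, $\nabla T_\alpha(u_j)\to\nabla T_\alpha(u)$ in $L^p_{\mathrm{loc}}(\mathbb{R}^n;\mathbb{R}^n)$ as $j\to\infty$. Then $u$ is a localized asymptotic solution of this equation.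
   Context: $\Lambda^p(\mathbb{R}^n)$: measurable $u$ with $\int\min(|u|,1)^p\,dx<\infty$. $T_t(s)=\max\{-t,\min\{s,t\}\}$. $\mathrm{X}=\{v\in W^{1,p}(\mathbb{R}^n):\int V|v|^p\,dx<\infty\}$, $\|v\|_{\mathrm{X}}=\bigl(\int|\nabla v|^p+\int V|v|^p\bigr)^{1/p}$. For $g\in L^1\cap L^{p'}$, the weak energy solution with datum $g$ is the unique $w\in\mathrm{X}$ with $\int|\nabla w|^{p-2}\nabla w\cdot\nabla\varphi+\int V|w|^{p-2}w\varphi=\int g\varphi$ for all $\varphi\in\mathrm{X}$. $u\in\Lambda^p$ is an asymptotic energy solution with datum $f$ if (i) $T_\alpha(u)\in\mathrm{X}$ for all $\alpha>0$ and (ii) there exist $f_j\in L^1\cap L^{p'}$ with $f_j\to f$ in $L^1$ such that the weak energy solutions $u_j$ with data $f_j$ satisfy $T_\alpha(u_j-u)\to0$ in $\mathrm{X}$ for all $\alpha>0$; such $\{u_j\}$ is called an approximate sequence for $u$ (with data $\{f_j\}$). For $\alpha,t>0$ and measurable $v,\phi$, $\mathcal H_{\alpha,t}(v,\phi)=T_t(T_\alpha(v)-\phi)-T_t(T_\alpha(v))$. A function $u\in\Lambda^p(\mathbb{R}^n)$ is a localized asymptotic solution if (i) $T_\alpha(u)\in\mathrm{X}$ for all $\alpha>0$, and (ii) for every $t>0$, every compactly supported $\phi\in W^{1,p}(\mathbb{R}^n)\cap L^\infty(\mathbb{R}^n)$ and every $\alpha>t+\|\phi\|_\infty$, \[\int|\nabla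 T_\alpha(u)|^{p-2}\nabla T_\alpha(u)\cdot\nabla\mathcal H_{\alpha,t}(u,\phi)\,dx+\int V|T_\alpha(u)|^{p-2}T_\alpha(u)\mathcal H_{\alpha,t}(u,\phi)\,dx=\int f\,\mathcal H_{\alpha,t}(u,\phi)\,dx.\] *)

theory Defs
  imports "HOL-Analysis.Analysis" "HOL-Probability.Essential_Supremum"
begin

definition Lp :: "real \<Rightarrow> ('a::euclidean_space \<Rightarrow> real) \<Rightarrow> bool" where
  "Lp p f \<longleftrightarrow> f \<in> borel_measurable lebesgue \<and> integrable lebesgue (\<lambda>x. \<bar>f x\<bar> powr p)"

definition L1loc :: "('a::euclidean_space \<Rightarrow> real) \<Rightarrow> bool" where
  "L1loc f \<longleftrightarrow> f \<in> borel_measurable lebesgue \<and> (\<forall>K. compact K \<longrightarrow> set_integrable lebesgue K f)"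

definition Linf_loc :: "('a::euclidean_space \<Rightarrow> real) \<Rightarrow> bool" where
  "Linf_loc f \<longleftrightarrow> f \<in> borel_measurable lebesgue \<and>
     (\<forall>K. compact K \<longrightarrow> (\<exists>C. AE x in lebesgue. x \<in> K \<longrightarrow> \<bar>f x\<bar> \<le> C))"

definition partial :: "('a::euclidean_space \<Rightarrow> real) \<Rightarrow> 'a \<Rightarrow> 'a \<Rightarrow> real" where
  "partial f i x = frechet_derivative f (at x) i"

fun Ck :: "nat \<Rightarrow> ('a::euclidean_space \<Rightarrow> real) \<Rightarrow> bool" where
  "Ck 0 f \<longleftrightarrow> continuous_on UNIV f"
| "Ck (Suc k) f \<longleftrightarrow> (\<forall>x. f differentiable (at x)) \<and> (\<forall>i\<in>Basis. Ck k (partial f i))"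

definition test_fun :: "('a::euclidean_space \<Rightarrow> real) \<Rightarrow> bool" where
  "test_fun \<phi> \<longleftrightarrow> (\<forall>k. Ck k \<phi>) \<and> (\<exists>K. compact K \<and> (\<forall>x. x \<notin> K \<longrightarrow> \<phi> x = 0))"

definition is_weak_grad :: "('a::euclidean_space \<Rightarrow> real) \<Rightarrow> ('a \<Rightarrow> 'a) \<Rightarrow> bool" where
  "is_weak_grad u G \<longleftrightarrow> L1loc u \<and> (\<forall>i\<in>Basis. L1loc (\<lambda>x. G x \<bullet> i)) \<and>
     (\<forall>\<phi>. test_fun \<phi> \<longrightarrow> (\<forall>i\<in>Basis.
        (\<integral>x. u x * partial \<phi> i x \<partial>lebesgue) = - (\<integral>x. (G x \<bullet> i) * \<phi> x \<partial>lebesgue)))"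

text \<open>The weak gradient (unique up to a.e. equality, so all integrals below are well-defined).\<close>
definition wgrad :: "('a::euclidean_space \<Rightarrow> real) \<Rightarrow> 'a \<Rightarrow> 'a" where
  "wgrad u = (SOME G. is_weak_grad u G)"

definition W1p :: "real \<Rightarrow> ('a::euclidean_space \<Rightarrow> real) \<Rightarrow> bool" where
  "W1p p u \<longleftrightarrow> Lp p u \<and> (\<exists>G. is_weak_grad u G \<and> Lp p (\<lambda>x. norm (G x)))"

definition Lambda_p :: "real \<Rightarrow> ('a::euclidean_space \<Rightarrow> real) \<Rightarrow> bool" where
  "Lambda_p p u \<longleftrightarrow> u \<in> borel_measurable lebesgue \<and>
     integrable lebesgue (\<lambda>x. (min \<bar>u x\<bar> 1) powr p)"

definition T :: "real \<Rightarrow> real \<Rightarrow> real" where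
  "T t s = max (-t) (min s t)"

definition inX :: "('a::euclidean_space \<Rightarrow> real) \<Rightarrow> real \<Rightarrow> ('a \<Rightarrow> real) \<Rightarrow> bool" where
  "inX V p v \<longleftrightarrow> W1p p v \<and> integrable lebesgue (\<lambda>x. V x * \<bar>v x\<bar> powr p)"

definition normX :: "('a::euclidean_space \<Rightarrow> real) \<Rightarrow> real \<Rightarrow> ('a \<Rightarrow> real) \<Rightarrow> real" where
  "normX V p v = ((\<integral>x. norm (wgrad v x) powr p \<partial>lebesgue) + (\<integral>x. V x * \<bar>v x\<bar> powr p \<partial>lebesgue)) powr (1/p)"

definition weak_energy_sol :: "('a::euclidean_space \<Rightarrow> real) \<Rightarrow> real \<Rightarrow> ('a \<Rightarrow> real) \<Rightarrow> ('a \<Rightarrow> real) \<Rightarrow> bool" where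
  "weak_energy_sol V p g w \<longleftrightarrow> inX V p w \<and>
     (\<forall>\<phi>. inX V p \<phi> \<longrightarrow>
        (\<integral>x. norm (wgrad w x) powr (p - 2) * (wgrad w x \<bullet> wgrad \<phi> x) \<partial>lebesgue)
      + (\<integral>x. V x * \<bar>w x\<bar> powr (p - 2) * w x * \<phi> x \<partial>lebesgue)
      = (\<integral>x. g x * \<phi> x \<partial>lebesgue))"

definition approx_seq :: "('a::euclidean_space \<Rightarrow> real) \<Rightarrow> real \<Rightarrow> ('a \<Rightarrow> real) \<Rightarrow> ('a \<Rightarrow> real)
     \<Rightarrow> (nat \<Rightarrow> 'a \<Rightarrow> real) \<Rightarrow> (nat \<Rightarrow> 'a \<Rightarrow> real) \<Rightarrow> bool" where
  "approx_seq V p f u us fs \<longleftrightarrow>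
     (\<forall>j. integrable lebesgue (fs j) \<and> Lp (p / (p - 1)) (fs j)) \<and>
     (\<lambda>j. \<integral>x. \<bar>fs j x - f x\<bar> \<partial>lebesgue) \<longlonglongrightarrow> 0 \<and>
     (\<forall>j. weak_energy_sol V p (fs j) (us j)) \<and>
     (\<forall>\<alpha>>0. (\<forall>j. inX V p (\<lambda>x. T \<alpha> (us j x - u x))) \<and>
             (\<lambda>j. normX V p (\<lambda>x. T \<alpha> (us j x - u x))) \<longlonglongrightarrow> 0)"

definition asymptotic_energy_sol :: "('a::euclidean_space \<Rightarrow> real) \<Rightarrow> real \<Rightarrow> ('a \<Rightarrow> real) \<Rightarrow> ('a \<Rightarrow> real) \<Rightarrow> bool" where
  "asymptotic_energy_sol V p f u \<longleftrightarrow> Lambda_p p u \<and> (\<forall>\<alpha>>0. inX V p (\<lambda>x. T \<alpha> (u x))) \<and>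
     (\<exists>us fs. approx_seq V p f u us fs)"

definition HH :: "real \<Rightarrow> real \<Rightarrow> ('a \<Rightarrow> real) \<Rightarrow> ('a \<Rightarrow> real) \<Rightarrow> 'a \<Rightarrow> real" where
  "HH \<alpha> t v \<phi> = (\<lambda>x. T t (T \<alpha> (v x) - \<phi> x) - T t (T \<alpha> (v x)))"

definition Linf_norm :: "('a::euclidean_space \<Rightarrow> real) \<Rightarrow> ereal" where
  "Linf_norm \<phi> = esssup lebesgue (\<lambda>x. ereal \<bar>\<phi> x\<bar>)"

definition localized_asymptotic_sol :: "('a::euclidean_space \<Rightarrow> real) \<Rightarrow> real \<Rightarrow> ('a \<Rightarrow> real) \<Rightarrow> ('a \<Rightarrow> real) \<Rightarrow> bool" where
  "localized_asymptotic_sol V p f u \<longleftrightarrow> Lambda_p p u \<and> (\<forall>\<alpha>>0. inX V p (\<lambda>x. T \<alpha> (u x))) \<and>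
     (\<forall>t>0. \<forall>\<phi> \<alpha>. W1p p \<phi> \<and> Linf_norm \<phi> < \<infinity> \<and>
        (\<exists>K. compact K \<and> (AE x in lebesgue. x \<notin> K \<longrightarrow> \<phi> x = 0)) \<and>
        ereal \<alpha> > ereal t + Linf_norm \<phi> \<longrightarrow>
        (\<integral>x. norm (wgrad (\<lambda>y. T \<alpha> (u y)) x) powr (p - 2) *
              (wgrad (\<lambda>y. T \<alpha> (u y)) x \<bullet> wgrad (HH \<alpha> t u \<phi>) x) \<partial>lebesgue)
      + (\<integral>x. V x * \<bar>T \<alpha> (u x)\<bar> powr (p - 2) * T \<alpha> (u x) * HH \<alpha> t u \<phi> x \<partial>lebesgue)
      = (\<integral>x. f x * HH \<alpha> t u \<phi> x \<partial>lebesgue))"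

end

theory Submission
  imports Defs "HOL-Computational_Algebra.Polynomial"
begin

text \<open>The equation for \<open>u\<^sub>j\<close> is tested with \<open>\<psi>\<^sub>j = HH \<alpha> t u\<^sub>j \<phi>\<close>. Since \<open>\<alpha> > t + \<parallel>\<phi>\<parallel>\<close>, both \<open>\<psi>\<^sub>j\<close> and its gradient
  vanish where \<open>\<bar>u\<^sub>j\<bar> \<ge> \<alpha>\<close>, so only \<open>T \<alpha> u\<^sub>j\<close> enters; they also vanish off the support of \<open>\<phi>\<close>, so local convergence of
  \<open>\<nabla>T \<alpha> u\<^sub>j\<close> suffices. Along a subsequence with summable errors all integrands converge almost everywhere
  under an integrable majorant. The characteristic functions in \<open>\<nabla>\<psi>\<^sub>j\<close> may fail to converge only on level sets
  of \<open>T \<alpha> u\<close> and \<open>T \<alpha> u - \<phi>\<close>, where the corresponding gradients are zero.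

  The chain rule for truncations reduces to the positive part \<open>w\<^sup>+\<close>. By convexity, its difference quotients are
  compared with those of \<open>w\<close> on any set \<open>A\<close> with \<open>{w > 0} \<subseteq> A \<subseteq> {w \<ge> 0}\<close>, from one side for positive and from the
  other side for negative increments, which identifies the gradient of \<open>w\<^sup>+\<close> as \<open>1\<^sub>A \<nabla>w\<close>. The freedom in \<open>A\<close>
  forces \<open>\<nabla>w = 0\<close> almost everywhere on \<open>{w = 0}\<close>.\<close>

subsection \<open>Smooth functions and test functions\<close>

text \<open>Weak gradients are known only through integrals against test functions, and
  \<open>wgrad\<close> is an arbitrary choice among them. Two facts must therefore be won from test
  functions alone: uniqueness up to null sets, which lets explicit gradients replace the chosen
  ones, and the formula for gradients of truncations with its sharp sets. Explicit bumps, their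
  density among indicators and translation arguments serve these two facts.

  The obstacle in the limit is that \<open>u\<close> is not assumed to have a weak gradient; only
  its truncations are, and gradient convergence is given only on compact sets. Likewise
  \<open>V\<close> is bounded only on compact sets, so it is the compact support of
  \<open>\<phi>\<close> that puts the test function into the energy space. Pointwise convergence of
  \<open>us j\<close> comes from the zero order part of the energy norm of
  \<open>T 1 (us j - u)\<close>, where \<open>V \<ge> 1\<close> prevents degeneracy. This error is
  added to the local gradient error before a subsequence is chosen, so that one subsequence serves
  both. Passing to it costs nothing, since the limit equation no longer mentions
  \<open>j\<close>.\<close>

text \<open>\<open>flat n\<close> is the \<open>n\<close>-th derivative of \<open>exp (- 1 / t)\<close>, extended by \<open>0\<close> to \<open>t \<le> 0\<close>; differentiating
  \<open>q (1 / t) * exp (- 1 / t)\<close> gives the recursion \<open>q \<mapsto> s\<^sup>2 (q - q')\<close> for its polynomial factor.\<close>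

primrec flat_poly :: "nat \<Rightarrow> real poly" where
  "flat_poly 0 = 1"
| "flat_poly (Suc n) = [:0, 0, 1:] * (flat_poly n - pderiv (flat_poly n))"

definition flat :: "nat \<Rightarrow> real \<Rightarrow> real" where
  "flat n t = (if t > 0 then poly (flat_poly n) (1 / t) * exp (- 1 / t) else 0)"

lemma poly_times_exp_minus_tendsto_0:
  fixes q :: "real poly"
  shows "((\<lambda>s. poly q s * exp (- s)) \<longlongrightarrow> 0) at_top"
proof -
  have "((\<lambda>s. \<Sum>i\<le>degree q. coeff q i * (s ^ i / exp s)) \<longlongrightarrow> (\<Sum>i\<le>degree q. coeff q i * 0)) at_top"
    by (intro tendsto_sum tendsto_mult tendsto_const tendsto_power_div_exp_0)
  moreover have "(\<lambda>s. \<Sum>i\<le>degree q. coeff q i * (s ^ i / exp s)) = (\<lambda>s. poly q s * exp (- s))"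
    by (auto simp: poly_altdef sum_distrib_right sum_divide_distrib exp_minus field_simps)
  ultimately show ?thesis by simp
qed

lemma flat_has_derivative:
  "(flat n has_real_derivative flat (Suc n) t) (at t)"
proof (cases "t = 0")
  case False
  show ?thesis
  proof (cases "t > 0")
    case True
    let ?g = "\<lambda>t. poly (flat_poly n) (1 / t) * exp (- 1 / t)"
    have "(?g has_real_derivative flat (Suc n) t) (at t)"
      using True
      by (auto intro!: derivative_eq_intros simp: flat_def field_simps power2_eq_square)
    moreover have "\<forall>\<^sub>F s in nhds t. flat n s = ?g s"
      using eventually_nhds_in_open[of "{0<..}" t] True
      by (auto elim!: eventually_mono simp: flat_def)
    ultimately show ?thesis
      using DERIV_cong_ev[OF refl _ refl, of "flat n" ?g t] by blast
  next
    case neg: False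
    then have "\<forall>\<^sub>F s in nhds t. flat n s = 0"
      using eventually_nhds_in_open[of "{..<0}" t] False
      by (auto elim!: eventually_mono simp: flat_def)
    moreover have "flat (Suc n) t = 0"
      using neg by (simp add: flat_def)
    ultimately show ?thesis
      using DERIV_cong_ev[OF refl _ refl, of "flat n" "\<lambda>_. 0" t] by simp
  qed
next
  case True
  \<comment> \<open>Dividing by \<open>s\<close> adds one power of \<open>1 / s\<close>, hence the
    extra factor. The limit from the right becomes the decay of a polynomial times
    \<open>exp (- s)\<close> at infinity.\<close>
  let ?q = "[:0, 1:] * flat_poly n"
  have "((\<lambda>s. flat n s / s) \<longlongrightarrow> 0) (at_left 0)"
    by (rule tendsto_eventually) (auto simp: eventually_at_filter flat_def)
  moreover have "((\<lambda>s. flat n s / s) \<longlongrightarrow> 0) (at_right 0)"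
  proof -
    have "((\<lambda>s. poly ?q (inverse s) * exp (- inverse s)) \<longlongrightarrow> 0) (at_right (0::real))"
      by (rule filterlim_compose[OF poly_times_exp_minus_tendsto_0 filterlim_inverse_at_top_right])
    moreover have "\<forall>\<^sub>F s in at_right 0. poly ?q (inverse s) * exp (- inverse s) = flat n s / s"
      by (auto simp: eventually_at_filter flat_def field_simps)
    ultimately show ?thesis
      by (simp cong: tendsto_cong)
  qed
  ultimately have "((\<lambda>s. flat n s / s) \<longlongrightarrow> 0) (at 0)"
    by (rule filterlim_split_at_real)
  then show ?thesis
    using True by (simp add: has_field_derivative_iff flat_def)
qed

lemma flat_nonneg: "0 \<le> flat 0 t" and flat_le_1: "flat 0 t \<le> 1"
  by (auto simp: flat_def)

lemma flat_pos_iff: "0 < flat 0 t \<longleftrightarrow> 0 < t"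
  by (auto simp: flat_def)

lemma flat_mult_pos_iff: "0 < flat 0 s * flat 0 t \<longleftrightarrow> 0 < s \<and> 0 < t"
  using flat_pos_iff flat_nonneg by (metis less_le mult_eq_0_iff mult_pos_pos)

text \<open>\<open>exp (- 1 / (k * t))\<close> tends to 1 for \<open>t > 0\<close>, so dilation
  steepens the smooth step to the Heaviside function with value 0 at the origin. That value makes
  products of such steps converge to indicators of open boxes. \<open>Suc k\<close> keeps the
  dilation factor positive.\<close>

lemma flat_dilation_tendsto:
  "(\<lambda>k. flat 0 (real (Suc k) * t)) \<longlonglongrightarrow> (if t > 0 then 1 else 0)"
proof (cases "t > 0")
  case True
  have "(\<lambda>k. exp (- ((1 / t) * inverse (real (Suc k))))) \<longlonglongrightarrow> exp (- ((1 / t) * 0))"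
    by (intro tendsto_intros LIMSEQ_inverse_real_of_nat)
  moreover have "flat 0 (real (Suc k) * t) = exp (- ((1 / t) * inverse (real (Suc k))))" for k
    using True by (simp add: flat_def field_simps add_pos_nonneg)
  ultimately show ?thesis
    using True by simp
next
  case False
  then have "flat 0 (real (Suc k) * t) = 0" for k
    by (auto simp: flat_def zero_less_mult_iff)
  then show ?thesis
    using False by simp
qed

section \<open>Calculus of functions of class \<open>Ck\<close> and of test functions\<close>

lemma partial_eqI: "(f has_derivative f') (at x) \<Longrightarrow> partial f i x = f' i"
  unfolding partial_def using frechet_derivative_at by fastforce

lemma partial_works: "f differentiable (at x) \<Longrightarrow> (f has_derivative frechet_derivative f (at x)) (at x)"
  by (simp add: frechet_derivative_works)

text \<open>\<open>Ck (Suc k)\<close> speaks only of differentiability and of the partial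
  derivatives, so monotonicity in \<open>k\<close> is a fact to be proved. The product rule relies
  on it, because there each factor also occurs undifferentiated.\<close>

lemma Ck_Suc_imp_Ck: "Ck (Suc k) f \<Longrightarrow> Ck k f"
proof (induction k arbitrary: f)
  case 0
  then show ?case
    by (auto simp: continuous_on_eq_continuous_at intro: differentiable_imp_continuous_within)
next
  case (Suc k)
  show ?case
    using Suc.prems Suc.IH by (subst Ck.simps(2)) (auto simp del: Ck.simps simp: Ck.simps(2)[of "Suc k"])
qed

lemma Ck_const: "Ck k (\<lambda>x. c)"
proof (induction k arbitrary: c)
  case (Suc k)
  have "partial (\<lambda>x. c) i = (\<lambda>x. 0)" for i :: 'a
    by (rule ext, rule partial_eqI[where f' = "\<lambda>_. 0"]) simp
  then show ?case using Suc by simp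
qed simp

lemma Ck_add: "Ck k f \<Longrightarrow> Ck k g \<Longrightarrow> Ck k (\<lambda>x. f x + g x)"
proof (induction k arbitrary: f g)
  case (Suc k)
  have "partial (\<lambda>x. f x + g x) i = (\<lambda>x. partial f i x + partial g i x)" for i :: 'a
    using Suc.prems unfolding partial_def[of f] partial_def[of g]
    by (intro ext partial_eqI[where f' = "\<lambda>v. frechet_derivative f (at x) v + frechet_derivative g (at x) v" for x])
      (auto intro!: has_derivative_add partial_works)
  then show ?case using Suc by (auto intro!: differentiable_add)
qed (auto intro: continuous_on_add)

lemma partial_mult:
  assumes "f differentiable (at x)" "g differentiable (at x)"
  shows "partial (\<lambda>x. f x * g x) i x = partial f i x * g x + f x * partial g i x"
  using has_derivative_mult[OF partial_works[OF assms(1)] partial_works[OF assms(2)]]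
  unfolding partial_def[of f] partial_def[of g]
  by (subst partial_eqI) (auto simp: algebra_simps)

lemma Ck_mult: "Ck k f \<Longrightarrow> Ck k g \<Longrightarrow> Ck k (\<lambda>x. f x * g x)"
proof (induction k arbitrary: f g)
  case (Suc k)
  have "partial (\<lambda>x. f x * g x) i = (\<lambda>x. partial f i x * g x + f x * partial g i x)" for i :: 'a
    using Suc.prems by (intro ext partial_mult) auto
  moreover have "Ck k f" "Ck k g"
    using Suc.prems by (auto intro: Ck_Suc_imp_Ck)
  ultimately show ?case
    using Suc by (auto intro!: differentiable_mult Ck_add)
qed (auto intro: continuous_on_mult)

lemma Ck_prod:
  "(\<And>i. i \<in> I \<Longrightarrow> Ck k (f i)) \<Longrightarrow> Ck k (\<lambda>x. \<Prod>i\<in>I. f i x)"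
  by (induction I rule: infinite_finite_induct) (auto intro: Ck_const Ck_mult)

text \<open>Each derivative raises the index of \<open>flat\<close> and leaves a constant factor, so
  the induction has to range over all \<open>n\<close>.\<close>

lemma Ck_flat: "Ck k (\<lambda>x. flat n (c * (x \<bullet> v) + d))"
proof (induction k arbitrary: n)
  case 0
  have "continuous_on UNIV (flat n)"
    by (auto simp: continuous_on_eq_continuous_at intro: DERIV_isCont[OF flat_has_derivative])
  then have "continuous_on UNIV (\<lambda>x. flat n (c * (x \<bullet> v) + d))"
    by (rule continuous_on_compose2) (auto intro!: continuous_intros)
  then show ?case by simp
next
  case (Suc k)
  have der: "((\<lambda>x. flat n (c * (x \<bullet> v) + d)) has_derivative
      (\<lambda>y. c * (y \<bullet> v) * flat (Suc n) (c * (x \<bullet> v) + d))) (at x)" for x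
  proof -
    have "((\<lambda>x. c * (x \<bullet> v) + d) has_derivative (\<lambda>y. c * (y \<bullet> v))) (at x)"
      by (auto intro!: derivative_eq_intros)
    from has_derivative_compose[OF this, of "flat n" "(*) (flat (Suc n) (c * (x \<bullet> v) + d))"]
    show ?thesis
      using flat_has_derivative[of n "c * (x \<bullet> v) + d"]
      by (simp add: has_field_derivative_def mult.commute)
  qed
  then have "partial (\<lambda>x. flat n (c * (x \<bullet> v) + d)) i
      = (\<lambda>x. c * (i \<bullet> v) * flat (Suc n) (c * (x \<bullet> v) + d))" for i
    by (intro ext partial_eqI)
  then show ?case
    using Suc der by (auto intro!: Ck_mult Ck_const simp: differentiable_def)
qed

text \<open>Both functions have the same derivatives in the sense of \<open>has_derivative\<close>,
  so the choice behind \<open>frechet_derivative\<close> returns the same map, also at points of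
  non-differentiability.\<close>

lemma partial_translate: "partial (\<lambda>x. f (x + c)) i x = partial f i (x + c)"
  unfolding partial_def
proof -
  have *: "((\<lambda>x. f (x + c)) has_derivative D) (at x) \<longleftrightarrow> (f has_derivative D) (at (x + c))" for D
  proof
    assume "(f has_derivative D) (at (x + c))"
    moreover have "((\<lambda>x. x + c) has_derivative (\<lambda>y. y)) (at x)"
      by (auto intro!: derivative_eq_intros)
    ultimately show "((\<lambda>x. f (x + c)) has_derivative D) (at x)"
      using has_derivative_compose by blast
  next
    assume "((\<lambda>x. f (x + c)) has_derivative D) (at x)"
    then have "((\<lambda>x. f (x + c)) has_derivative D) (at ((x + c) - c))"
      by simp
    moreover have "((\<lambda>x. x - c) has_derivative (\<lambda>y. y)) (at (x + c))"
      by (auto intro!: derivative_eq_intros)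
    ultimately have "((\<lambda>x. f (x - c + c)) has_derivative D) (at (x + c))"
      by (rule has_derivative_compose[rotated])
    then show "(f has_derivative D) (at (x + c))"
      by simp
  qed
  show "frechet_derivative (\<lambda>x. f (x + c)) (at x) i = frechet_derivative f (at (x + c)) i"
    unfolding frechet_derivative_def * ..
qed

lemma Ck_translate: "Ck k f \<Longrightarrow> Ck k (\<lambda>x. f (x + c))"
proof (induction k arbitrary: f)
  case 0
  then show ?case
    by (auto intro!: continuous_on_compose2[of UNIV f] continuous_intros)
next
  case (Suc k)
  have "(\<lambda>x. f (x + c)) differentiable (at x)" for x
    using Suc.prems differentiable_compose[of f "\<lambda>x. x + c" x UNIV] by (auto intro!: derivative_intros)
  moreover have "partial (\<lambda>x. f (x + c)) i = (\<lambda>x. partial f i (x + c))" for i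
    by (rule ext) (rule partial_translate)
  ultimately show ?case
    using Suc by simp
qed

lemma test_funI: "(\<And>k. Ck k \<phi>) \<Longrightarrow> compact K \<Longrightarrow> (\<And>x. x \<notin> K \<Longrightarrow> \<phi> x = 0) \<Longrightarrow> test_fun \<phi>"
  unfolding test_fun_def by blast

lemma test_fun_add:
  assumes "test_fun f" "test_fun g" shows "test_fun (\<lambda>x. f x + g x)"
proof -
  from assms obtain K L where "compact K" "\<And>x. x \<notin> K \<Longrightarrow> f x = 0" "compact L" "\<And>x. x \<notin> L \<Longrightarrow> g x = 0"
    unfolding test_fun_def by blast
  then show ?thesis
    using assms by (intro test_funI[of _ "K \<union> L"]) (auto simp: test_fun_def intro: Ck_add)
qed

lemma test_fun_mult_Ck:
  assumes "test_fun f" "\<And>k. Ck k g" shows "test_fun (\<lambda>x. f x * g x)"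
  using assms unfolding test_fun_def by (auto intro: Ck_mult)

lemma test_fun_mult: "test_fun f \<Longrightarrow> test_fun g \<Longrightarrow> test_fun (\<lambda>x. f x * g x)"
  by (rule test_fun_mult_Ck) (auto simp: test_fun_def)

lemma test_fun_cmult: "test_fun f \<Longrightarrow> test_fun (\<lambda>x. c * f x)"
  using test_fun_mult_Ck[of f "\<lambda>_. c"] by (simp add: mult.commute Ck_const)

lemma test_fun_diff: "test_fun f \<Longrightarrow> test_fun g \<Longrightarrow> test_fun (\<lambda>x. f x - g x)"
  using test_fun_add[OF _ test_fun_cmult[of g "-1"]] by simp

lemma test_fun_0: "test_fun (\<lambda>x. 0)"
  by (rule test_funI[of _ "{}"]) (auto intro: Ck_const)

lemma test_fun_translate:
  assumes "test_fun f" shows "test_fun (\<lambda>x. f (x + c))"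
proof -
  from assms obtain K where K: "compact K" "\<And>x. x \<notin> K \<Longrightarrow> f x = 0"
    unfolding test_fun_def by blast
  have "compact ((\<lambda>x. x - c) ` K)"
    using K(1) by (intro compact_continuous_image continuous_intros)
  moreover have "f (x + c) = 0" if "x \<notin> (\<lambda>x. x - c) ` K" for x
    using that K(2)[of "x + c"] by (metis add_diff_cancel_right' image_eqI)
  ultimately show ?thesis
    using assms by (intro test_funI) (auto simp: test_fun_def intro: Ck_translate)
qed

lemma test_fun_differentiable: "test_fun f \<Longrightarrow> f differentiable (at x)"
  unfolding test_fun_def using Ck.simps(2) by blast

lemma test_fun_continuous: "test_fun f \<Longrightarrow> continuous_on S f"
  unfolding test_fun_def using Ck.simps(1) continuous_on_subset by blast

lemma continuous_on_partial_test_fun: "test_fun f \<Longrightarrow> i \<in> Basis \<Longrightarrow> continuous_on S (partial f i)"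
  unfolding test_fun_def using Ck.simps(1) Ck.simps(2)[of 0] continuous_on_subset by blast

lemma partial_eq_0_outside:
  assumes "closed K" "\<And>x. x \<notin> K \<Longrightarrow> f x = 0" "x \<notin> K"
  shows "partial f i x = 0"
proof -
  have "(f has_derivative (\<lambda>_. 0)) (at x)"
    by (rule has_derivative_transform_within_open[of "\<lambda>_. 0" _ _ UNIV "- K"]) (use assms in auto)
  then show ?thesis by (rule partial_eqI)
qed

lemma test_fun_bounds:
  assumes "test_fun f" "i \<in> Basis"
  obtains K M where "compact K" "M > 0" "\<And>x. x \<notin> K \<Longrightarrow> f x = 0" "\<And>x. x \<notin> K \<Longrightarrow> partial f i x = 0"
    "\<And>x. \<bar>f x\<bar> \<le> M" "\<And>x. \<bar>partial f i x\<bar> \<le> M"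
proof -
  from assms obtain K where K: "compact K" "\<And>x. x \<notin> K \<Longrightarrow> f x = 0"
    unfolding test_fun_def by blast
  then have K': "\<And>x. x \<notin> K \<Longrightarrow> partial f i x = 0"
    by (intro partial_eq_0_outside[of K]) (auto intro: compact_imp_closed)
  have "bounded (f ` K)" "bounded (partial f i ` K)"
    using K(1) assms test_fun_continuous continuous_on_partial_test_fun
    by (auto intro!: compact_imp_bounded compact_continuous_image)
  then obtain A B where "\<And>x. x \<in> K \<Longrightarrow> \<bar>f x\<bar> \<le> A" "\<And>x. x \<in> K \<Longrightarrow> \<bar>partial f i x\<bar> \<le> B"
    unfolding bounded_iff by force
  \<comment> \<open>The 1 makes the common bound strictly positive, so that later estimates may
    divide by it.\<close>
  then have "\<bar>f x\<bar> \<le> max 1 (max A B)" "\<bar>partial f i x\<bar> \<le> max 1 (max A B)" for x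
    using K(2)[of x] K'[of x] by (cases "x \<in> K"; force)+
  then show ?thesis
    using K K' that[of K "max 1 (max A B)"] by auto
qed

text \<open>The two factors of a coordinate are positive exactly when it lies strictly between its
  bounds, so positivity singles out the open box. Growing \<open>k\<close> steepens the flanks
  inwards, with the support staying in the closed box.\<close>

definition bump :: "'a::euclidean_space \<Rightarrow> 'a \<Rightarrow> nat \<Rightarrow> 'a \<Rightarrow> real" where
  "bump a b k x = (\<Prod>i\<in>Basis. flat 0 (real (Suc k) * ((x - a) \<bullet> i)) * flat 0 (real (Suc k) * ((b - x) \<bullet> i)))"

lemma bump_nonneg: "0 \<le> bump a b k x"
  unfolding bump_def by (intro prod_nonneg mult_nonneg_nonneg ballI flat_nonneg)

lemma bump_le_1: "bump a b k x \<le> 1"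
  unfolding bump_def
  by (rule prod_le_1) (auto intro!: mult_le_one mult_nonneg_nonneg flat_nonneg flat_le_1)

lemma bump_pos_iff: "0 < bump a b k x \<longleftrightarrow> x \<in> box a b"
proof -
  have "0 < bump a b k x \<longleftrightarrow> (\<forall>i\<in>Basis. flat 0 (real (Suc k) * ((x - a) \<bullet> i)) * flat 0 (real (Suc k) * ((b - x) \<bullet> i)) > 0)"
    unfolding bump_def
    by (auto intro!: prod_pos simp: less_le bump_nonneg flat_nonneg prod_nonneg)
  also have "\<dots> \<longleftrightarrow> x \<in> box a b"
    unfolding flat_mult_pos_iff by (auto simp: mem_box inner_diff_left zero_less_mult_iff)
  finally show ?thesis .
qed

lemma bump_tendsto: "(\<lambda>k. bump a b k x) \<longlonglongrightarrow> indicator (box a b) x"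
proof -
  have "(\<lambda>k. bump a b k x) \<longlonglongrightarrow>
      (\<Prod>i\<in>Basis. (if (x - a) \<bullet> i > 0 then 1 else 0) * (if (b - x) \<bullet> i > 0 then 1 else 0))"
    unfolding bump_def by (intro tendsto_prod tendsto_mult flat_dilation_tendsto)
  moreover have "(\<Prod>i\<in>Basis. (if (x - a) \<bullet> i > 0 then 1 else 0) * (if (b - x) \<bullet> i > 0 then 1 else 0))
      = (indicator (box a b) x :: real)"
    by (auto simp: indicator_def mem_box inner_diff_left prod_zero_iff intro!: prod.neutral)
  ultimately show ?thesis by simp
qed

lemma test_fun_bump: "test_fun (bump a b k)"
proof (rule test_funI)
  fix n
  have eq: "bump a b k = (\<lambda>x. \<Prod>i\<in>Basis. flat 0 (real (Suc k) * (x \<bullet> i) + (- real (Suc k) * (a \<bullet> i)))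
      * flat 0 ((- real (Suc k)) * (x \<bullet> i) + real (Suc k) * (b \<bullet> i)))"
    unfolding bump_def by (intro ext prod.cong refl arg_cong2[where f = "(*)"] arg_cong[where f = "flat 0"])
      (auto simp: inner_diff_left algebra_simps)
  show "Ck n (bump a b k)"
    unfolding eq by (intro Ck_prod Ck_mult Ck_flat)
next
  show "compact (cbox a b)" by (rule compact_cbox)
next
  fix x assume "x \<notin> cbox a b"
  then have "x \<notin> box a b"
    using box_subset_cbox by blast
  then show "bump a b k x = 0"
    using bump_pos_iff bump_nonneg by (metis less_eq_real_def)
qed

lemma compact_subset_box:
  fixes K :: "'a::euclidean_space set"
  assumes "compact K" obtains a where "K \<subseteq> box (- a) a"
  using bounded_subset_box_symmetric[OF compact_imp_bounded[OF assms]] by blast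

text \<open>A bump on a box around the support is bounded below there, so a multiple of it
  dominates. The majorant replaces the splitting of \<open>f\<close> into positive and negative
  part, which would destroy smoothness.\<close>

lemma test_fun_dominated:
  fixes f :: "'a::euclidean_space \<Rightarrow> real"
  assumes "test_fun f"
  obtains g where "test_fun g" "\<And>x. \<bar>f x\<bar> \<le> g x"
proof -
  from assms obtain K where K: "compact K" "\<And>x. x \<notin> K \<Longrightarrow> f x = 0"
    unfolding test_fun_def by blast
  obtain a where a: "K \<subseteq> box (- a) a"
    using compact_subset_box[OF K(1)] .
  let ?b = "bump (- a) a 0"
  have pos: "?b x > 0" if "x \<in> K" for x
    using that a bump_pos_iff by blast
  have "continuous_on K (\<lambda>x. \<bar>f x\<bar> / ?b x)"
    using pos assms by (intro continuous_intros test_fun_continuous test_fun_bump) force+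
  then have "bounded ((\<lambda>x. \<bar>f x\<bar> / ?b x) ` K)"
    using K(1) by (intro compact_imp_bounded compact_continuous_image)
  then obtain C where C: "\<And>x. x \<in> K \<Longrightarrow> \<bar>\<bar>f x\<bar> / ?b x\<bar> \<le> C"
    unfolding bounded_iff by auto
  have "\<bar>f x\<bar> \<le> \<bar>C\<bar> * ?b x" for x
  proof (cases "x \<in> K")
    case True
    then have "\<bar>f x\<bar> / ?b x \<le> \<bar>C\<bar>" using C[OF True] by linarith
    then show ?thesis using pos[OF True] by (simp add: divide_le_eq)
  next
    case False
    then show ?thesis using K(2) bump_nonneg[of "-a" a 0 x] by simp
  qed
  then show ?thesis
    by (intro that[of "\<lambda>x. \<bar>C\<bar> * ?b x"] test_fun_cmult test_fun_bump)
qed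

subsection \<open>Translations and density of test functions\<close>

lemma borel_measurable_lebesgueI: "f \<in> borel_measurable borel \<Longrightarrow> f \<in> borel_measurable lebesgue"
  by (simp add: measurable_completion)

lemma lebesgue_translate_measurable:
  fixes c :: "'a::euclidean_space"
  shows "(\<lambda>x. x + c) \<in> lebesgue \<rightarrow>\<^sub>M lebesgue"
  using lebesgue_affine_measurable[of "\<lambda>_. 1" c]
  by (simp add: euclidean_representation add.commute)

lemma distr_lebesgue_translate:
  fixes c :: "'a::euclidean_space"
  shows "distr lebesgue lebesgue (\<lambda>x. x + c) = lebesgue"
  using lebesgue_affine_euclidean[of "\<lambda>_. 1" c]
  by (simp add: euclidean_representation add.commute density_1)

lemma borel_measurable_translate:
  fixes f :: "'a::euclidean_space \<Rightarrow> real"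
  shows "f \<in> borel_measurable lebesgue \<Longrightarrow> (\<lambda>x. f (x + c)) \<in> borel_measurable lebesgue"
  using measurable_compose[OF lebesgue_translate_measurable] by blast

lemma integrable_translate:
  fixes f :: "'a::euclidean_space \<Rightarrow> real"
  shows "integrable lebesgue f \<Longrightarrow> integrable lebesgue (\<lambda>x. f (x + c))"
  using integrable_distr[OF lebesgue_translate_measurable[of c], of f] by (simp add: distr_lebesgue_translate)

lemma integral_translate:
  fixes f :: "'a::euclidean_space \<Rightarrow> real"
  shows "f \<in> borel_measurable lebesgue \<Longrightarrow> (\<integral>x. f (x + c) \<partial>lebesgue) = (\<integral>x. f x \<partial>lebesgue)"
  using integral_distr[OF lebesgue_translate_measurable[of c], of f] by (simp add: distr_lebesgue_translate)

text \<open>A closed inner approximation is cut off by balls of growing radius; finite measure makes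
  what is lost tend to zero.\<close>

lemma lmeasurable_inner_compact:
  fixes A :: "'a::euclidean_space set"
  assumes "A \<in> lmeasurable" "e > 0"
  obtains K where "compact K" "K \<subseteq> A" "measure lebesgue (A - K) < e"
proof -
  obtain S where S: "closed S" "S \<subseteq> A" "A - S \<in> lmeasurable" "emeasure lebesgue (A - S) < ennreal e"
    using sets_lebesgue_inner_closed[of A e] assms by (auto simp: fmeasurableD)
  let ?K = "\<lambda>n. S \<inter> cball 0 (real n)"
  have K: "compact (?K n)" for n
    using S(1) by (simp add: closed_Int_compact)
  have "(\<lambda>n. measure lebesgue (A - ?K n)) \<longlonglongrightarrow> measure lebesgue (\<Inter>n. A - ?K n)"
  proof (rule Lim_measure_decseq)
    show "range (\<lambda>n. A - ?K n) \<subseteq> sets lebesgue"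
    proof (rule image_subsetI)
      show "A - ?K n \<in> sets lebesgue" for n
        using assms(1) lmeasurable_compact[OF K[of n]] by (intro sets.Diff fmeasurableD)
    qed
    show "decseq (\<lambda>n. A - ?K n)"
      by (force simp: decseq_def)
    show "emeasure lebesgue (A - ?K n) \<noteq> \<infinity>" for n
      using assms K by (metis fmeasurable_Diff fmeasurableD lmeasurable_compact emeasure_eq_measure2 ennreal_neq_top infinity_ennreal_def)
  qed
  moreover have "(\<Inter>n. A - ?K n) = A - S"
    by (auto intro: real_arch_simple)
  moreover have "measure lebesgue (A - S) < e"
    using S(3,4) assms(2) by (simp add: emeasure_eq_measure2 ennreal_less_iff)
  ultimately have "\<forall>\<^sub>F n in sequentially. measure lebesgue (A - ?K n) < e"
    using order_tendstoD(2) by metis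
  then obtain n where "measure lebesgue (A - ?K n) < e"
    using eventually_happens' sequentially_bot by blast
  then show ?thesis
    using that K[of n] S(2) by (metis inf.coboundedI1)
qed

text \<open>Induction over integrable functions. For an indicator, choose
  \<open>K \<subseteq> A \<subseteq> U\<close> with \<open>K\<close> compact, \<open>U\<close> open
  and small gaps. A shift shorter than the distance at which \<open>K\<close> stays inside
  \<open>U\<close> can change membership in \<open>A\<close> only if one of the two points lies in
  \<open>U - A\<close> or in \<open>A - K\<close>.\<close>

lemma L1_translation_continuous:
  fixes f :: "'a::euclidean_space \<Rightarrow> real"
  assumes "integrable lebesgue f" "e > 0"
  shows "\<exists>\<delta>>0. \<forall>c. norm c < \<delta> \<longrightarrow> (\<integral>x. \<bar>f (x + c) - f x\<bar> \<partial>lebesgue) \<le> e"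
  using assms
proof (induction arbitrary: e)
  case (base A r)
  have pos: "\<bar>r\<bar> + 1 > 0" by linarith
  \<comment> \<open>Four gaps contribute, each of measure below \<open>\<eta>\<close> and weighted
    with \<open>\<bar>r\<bar>\<close>; the added 1 takes care of \<open>r = 0\<close>.\<close>
  define \<eta> where "\<eta> = e / 4 / (\<bar>r\<bar> + 1)"
  have "\<eta> > 0" using base pos by (simp add: \<eta>_def)
  have \<eta>: "\<eta> * (\<bar>r\<bar> + 1) = e / 4"
    using nonzero_eq_divide_eq[of "\<bar>r\<bar> + 1" \<eta> "e / 4"] less_imp_neq[OF pos] \<eta>_def by metis
  have A: "A \<in> lmeasurable" using base by (intro fmeasurableI) auto
  obtain K where K: "compact K" "K \<subseteq> A" "measure lebesgue (A - K) < \<eta>"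
    using lmeasurable_inner_compact[OF A \<open>\<eta> > 0\<close>] .
  obtain U where U: "open U" "A \<subseteq> U" "U - A \<in> lmeasurable" "emeasure lebesgue (U - A) < ennreal \<eta>"
    using sets_lebesgue_outer_open[of A \<eta>] \<open>\<eta> > 0\<close> base by blast
  have U': "measure lebesgue (U - A) < \<eta>"
    using U(3,4) \<open>\<eta> > 0\<close> by (simp add: emeasure_eq_measure2 ennreal_less_iff)
  obtain \<delta> where \<delta>: "\<delta> > 0" "(\<Union>x\<in>K. ball x \<delta>) \<subseteq> U"
    using compact_subset_open_imp_ball_epsilon_subset[OF K(1) U(1)] K(2) U(2) by blast
  have AK: "A - K \<in> lmeasurable"
    using A K by (intro fmeasurable_Diff) (auto simp: lmeasurable_compact fmeasurableD)
  let ?I = "\<lambda>B x. indicator B x :: real"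
  have int: "integrable lebesgue (?I (U - A))" "integrable lebesgue (?I (A - K))"
    using U(3) AK by (auto simp: fmeasurable_def)
  have "(\<integral>x. \<bar>?I A (x + c) *\<^sub>R r - ?I A x *\<^sub>R r\<bar> \<partial>lebesgue) \<le> e" if c: "norm c < \<delta>" for c
  proof -
    have mem: "x + c \<in> U" "x - c \<in> U" if "x \<in> K" for x
      using \<delta>(2) that c by (auto simp: subset_eq dist_norm)
    let ?B = "\<lambda>x. ?I (U - A) x + ?I (A - K) x + ?I (U - A) (x + c) + ?I (A - K) (x + c)"
    have bd: "\<bar>?I A (x + c) - ?I A x\<bar> \<le> ?B x" for x
    proof (cases "x \<in> A"; cases "x + c \<in> A")
      assume "x \<in> A" "x + c \<notin> A"
      then have "x \<in> A - K \<or> x + c \<in> U - A" using mem(1)[of x] by blast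
      then show ?thesis using \<open>x \<in> A\<close> \<open>x + c \<notin> A\<close> by (auto simp: indicator_def)
    next
      assume "x \<notin> A" "x + c \<in> A"
      then have "x + c \<in> A - K \<or> x \<in> U - A" using mem(2)[of "x + c"] by auto
      then show ?thesis using \<open>x \<notin> A\<close> \<open>x + c \<in> A\<close> by (auto simp: indicator_def)
    qed simp_all
    have intB: "integrable lebesgue ?B"
      by (intro Bochner_Integration.integrable_add int integrable_translate)
    have "(\<integral>x. \<bar>?I A (x + c) *\<^sub>R r - ?I A x *\<^sub>R r\<bar> \<partial>lebesgue) \<le> (\<integral>x. \<bar>r\<bar> * ?B x \<partial>lebesgue)"
    proof (rule integral_mono')
      show "\<bar>?I A (x + c) *\<^sub>R r - ?I A x *\<^sub>R r\<bar> \<le> \<bar>r\<bar> * ?B x" for x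
        using mult_left_mono[OF bd[of x], of "\<bar>r\<bar>"] by (simp add: abs_mult[symmetric] algebra_simps del: abs_mult)
    qed (use intB in auto)
    also have "\<dots> = \<bar>r\<bar> * (2 * measure lebesgue (U - A) + 2 * measure lebesgue (A - K))"
      using int integrable_translate[OF int(1)] integrable_translate[OF int(2)]
        integral_translate[of "?I (U - A)"] integral_translate[of "?I (A - K)"]
      by (simp add: borel_measurable_integrable)
    also have "\<dots> \<le> \<bar>r\<bar> * (2 * \<eta> + 2 * \<eta>)"
      using U' K(3) by (intro mult_left_mono) auto
    also have "\<dots> = 4 * (\<eta> * (\<bar>r\<bar> + 1)) - 4 * \<eta>"
      by (simp add: algebra_simps)
    also have "\<dots> \<le> e"
      using \<eta> \<open>\<eta> > 0\<close> by linarith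
    finally show ?thesis .
  qed
  then show ?case using \<delta>(1) by blast
next
  case (add f g)
  obtain d1 where d1: "d1 > 0" "\<And>c. norm c < d1 \<Longrightarrow> (\<integral>x. \<bar>f (x + c) - f x\<bar> \<partial>lebesgue) \<le> e / 2"
    using add.IH(1)[of "e/2"] add.prems by auto
  obtain d2 where d2: "d2 > 0" "\<And>c. norm c < d2 \<Longrightarrow> (\<integral>x. \<bar>g (x + c) - g x\<bar> \<partial>lebesgue) \<le> e / 2"
    using add.IH(2)[of "e/2"] add.prems by auto
  have "(\<integral>x. \<bar>f (x + c) + g (x + c) - (f x + g x)\<bar> \<partial>lebesgue) \<le> e" if "norm c < min d1 d2" for c
  proof -
    have int: "integrable lebesgue (\<lambda>x. \<bar>f (x + c) - f x\<bar>)" "integrable lebesgue (\<lambda>x. \<bar>g (x + c) - g x\<bar>)"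
      using add.hyps by (auto intro!: integrable_translate)
    have "(\<integral>x. \<bar>f (x + c) + g (x + c) - (f x + g x)\<bar> \<partial>lebesgue)
        \<le> (\<integral>x. \<bar>f (x + c) - f x\<bar> + \<bar>g (x + c) - g x\<bar> \<partial>lebesgue)"
      by (rule integral_mono') (use int in auto)
    also have "\<dots> = (\<integral>x. \<bar>f (x + c) - f x\<bar> \<partial>lebesgue) + (\<integral>x. \<bar>g (x + c) - g x\<bar> \<partial>lebesgue)"
      using int by simp
    also have "\<dots> \<le> e" using d1(2)[of c] d2(2)[of c] that by simp
    finally show ?thesis .
  qed
  then show ?case using d1(1) d2(1) by (intro exI[of _ "min d1 d2"]) auto
next
  case (lim f s)
  \<comment> \<open>The induction supplies
    \<open>\<bar>s i x\<bar> \<le> 2 * \<bar>f x\<bar>\<close>, hence the majorant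
    \<open>3 * \<bar>f x\<bar>\<close>.\<close>
  have "(\<lambda>i. \<integral>x. \<bar>s i x - f x\<bar> \<partial>lebesgue) \<longlonglongrightarrow> (\<integral>x. 0 \<partial>(lebesgue :: 'a measure))"
  proof (rule integral_dominated_convergence[where w = "\<lambda>x. 3 * \<bar>f x\<bar>"])
    show "AE x in lebesgue. (\<lambda>i. \<bar>s i x - f x\<bar>) \<longlonglongrightarrow> 0"
    proof (rule AE_I2)
      fix x :: 'a
      have "(\<lambda>i. \<bar>s i x - f x\<bar>) \<longlonglongrightarrow> \<bar>f x - f x\<bar>"
        using lim.hyps(2)[of x] by (intro tendsto_intros) auto
      then show "(\<lambda>i. \<bar>s i x - f x\<bar>) \<longlonglongrightarrow> 0" by simp
    qed
    show "AE x in lebesgue. norm \<bar>s i x - f x\<bar> \<le> 3 * \<bar>f x\<bar>" for i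
    proof (rule AE_I2)
      fix x :: 'a
      show "norm \<bar>s i x - f x\<bar> \<le> 3 * \<bar>f x\<bar>"
        using lim.hyps(3)[of x i] by simp
    qed
  qed (use lim.hyps in auto)
  then have "\<forall>\<^sub>F i in sequentially. (\<integral>x. \<bar>s i x - f x\<bar> \<partial>lebesgue) < e / 3"
    using order_tendstoD(2)[of _ "0::real" _ "e/3"] lim.prems by simp
  then obtain i where i: "(\<integral>x. \<bar>s i x - f x\<bar> \<partial>lebesgue) < e / 3"
    using eventually_happens' sequentially_bot by blast
  obtain d where d: "d > 0" "\<And>c. norm c < d \<Longrightarrow> (\<integral>x. \<bar>s i (x + c) - s i x\<bar> \<partial>lebesgue) \<le> e / 3"
    using lim.IH[of "e/3" i] lim.prems by auto
  have "(\<integral>x. \<bar>f (x + c) - f x\<bar> \<partial>lebesgue) \<le> e" if "norm c < d" for c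
  proof -
    let ?d = "\<lambda>x. \<bar>s i x - f x\<bar>"
    have int: "integrable lebesgue ?d" "integrable lebesgue (\<lambda>x. \<bar>s i (x + c) - s i x\<bar>)"
      using lim.hyps(1,4) by (auto intro!: integrable_abs Bochner_Integration.integrable_diff integrable_translate)
    note int' = integrable_translate[OF int(1), of c]
    have "(\<integral>x. \<bar>f (x + c) - f x\<bar> \<partial>lebesgue) \<le> (\<integral>x. ?d (x + c) + ?d x + \<bar>s i (x + c) - s i x\<bar> \<partial>lebesgue)"
      by (rule integral_mono') (use int int' in auto)
    also have "\<dots> = (\<integral>x. ?d (x + c) \<partial>lebesgue) + (\<integral>x. ?d x \<partial>lebesgue) + (\<integral>x. \<bar>s i (x + c) - s i x\<bar> \<partial>lebesgue)"
      using int int' by simp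
    also have "(\<integral>x. ?d (x + c) \<partial>lebesgue) = (\<integral>x. ?d x \<partial>lebesgue)"
      by (rule integral_translate) (use int in auto)
    finally show ?thesis using i d(2)[OF that] by simp
  qed
  then show ?case using d(1) by blast
qed

section \<open>Density of test functions among indicators\<close>

lemma test_fun_measurable: "test_fun f \<Longrightarrow> f \<in> borel_measurable lebesgue"
  by (intro borel_measurable_lebesgueI borel_measurable_continuous_onI test_fun_continuous)

lemma partial_test_fun_measurable: "test_fun f \<Longrightarrow> i \<in> Basis \<Longrightarrow> partial f i \<in> borel_measurable lebesgue"
  by (intro borel_measurable_lebesgueI borel_measurable_continuous_onI continuous_on_partial_test_fun)

text \<open>The smooth counterpart of a union is \<open>1 - (1 - g) * (1 - b)\<close>: it is
  polynomial in both functions, preserves values in the unit interval, and becomes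
  inclusion-exclusion for the limiting indicators.\<close>

lemma test_fun_approx_finite_union_box:
  fixes a b :: "nat \<Rightarrow> 'a::euclidean_space"
  shows "\<exists>g. \<forall>k. test_fun (g k) \<and> (\<forall>x. 0 \<le> g k x \<and> g k x \<le> 1) \<and>
    (\<forall>x. (\<lambda>k. g k x) \<longlonglongrightarrow> indicator (\<Union>m<n. box (a m) (b m)) x)"
proof (induction n)
  case 0
  show ?case
    by (rule exI[of _ "\<lambda>_ _. 0"]) (auto intro: test_fun_0)
next
  case (Suc n)
  then obtain g where g: "\<And>k. test_fun (g k)" "\<And>k x. 0 \<le> g k x \<and> g k x \<le> 1"
    "\<And>x. (\<lambda>k. g k x) \<longlonglongrightarrow> indicator (\<Union>m<n. box (a m) (b m)) x" by blast
  let ?b = "bump (a n) (b n)"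
  let ?h = "\<lambda>k x. g k x + ?b k x - g k x * ?b k x"
  have bds: "0 \<le> ?h k x \<and> ?h k x \<le> 1" for k x
  proof -
    have "?h k x = 1 - (1 - g k x) * (1 - ?b k x)"
      by (simp add: algebra_simps)
    moreover have "0 \<le> (1 - g k x) * (1 - ?b k x)" "(1 - g k x) * (1 - ?b k x) \<le> 1"
      using g(2)[of k x] bump_nonneg[of "a n" "b n" k x] bump_le_1[of "a n" "b n" k x]
      by (auto intro!: mult_nonneg_nonneg mult_le_one)
    ultimately show ?thesis by auto
  qed
  moreover have "(\<lambda>k. ?h k x) \<longlonglongrightarrow> indicator (\<Union>m<Suc n. box (a m) (b m)) x" for x
  proof -
    have "(\<lambda>k. ?h k x) \<longlonglongrightarrow> indicator (\<Union>m<n. box (a m) (b m)) x + indicator (box (a n) (b n)) x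
        - indicator (\<Union>m<n. box (a m) (b m)) x * indicator (box (a n) (b n)) x"
      by (intro tendsto_intros g(3) bump_tendsto)
    moreover have "indicator (\<Union>m<n. box (a m) (b m)) x + indicator (box (a n) (b n)) x
        - indicator (\<Union>m<n. box (a m) (b m)) x * indicator (box (a n) (b n)) x
        = (indicator (\<Union>m<Suc n. box (a m) (b m)) x :: real)"
      by (auto simp: indicator_def less_Suc_eq)
    ultimately show ?thesis by simp
  qed
  moreover have "test_fun (?h k)" for k
    by (intro test_fun_diff test_fun_add test_fun_mult g(1) test_fun_bump)
  ultimately show ?case by (intro exI[of _ ?h]) auto
qed

text \<open>Three rounds of bounded limits: finite unions of boxes, open sets as countable unions of
  boxes, and measurable sets as intersections of open supersets up to a null set. Phrased as an
  induction rule, it carries equations and nonstrict bounds between integrals with an integrable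
  weight from test functions to indicators, each round being an application of dominated
  convergence.\<close>

lemma test_fun_dense_indicator [consumes 1, case_names test lim]:
  fixes P :: "('a::euclidean_space \<Rightarrow> real) \<Rightarrow> bool"
  assumes A: "A \<in> sets lebesgue"
    and test: "\<And>g. test_fun g \<Longrightarrow> (\<And>x. 0 \<le> g x) \<Longrightarrow> (\<And>x. g x \<le> 1) \<Longrightarrow> P g"
    and lim: "\<And>g h. (\<And>k. P (g k)) \<Longrightarrow> (\<And>k. g k \<in> borel_measurable lebesgue) \<Longrightarrow>
      (\<And>k x. \<bar>g k x\<bar> \<le> 1) \<Longrightarrow> h \<in> borel_measurable lebesgue \<Longrightarrow>
      (AE x in lebesgue. (\<lambda>k. g k x) \<longlonglongrightarrow> h x) \<Longrightarrow> P h"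
  shows "P (indicator A)"
proof -
  have un: "P (indicator (\<Union>m<n. box (a m) (b m)))" for n and a b :: "nat \<Rightarrow> 'a"
  proof -
    obtain g where g: "\<And>k. test_fun (g k)" "\<And>k x. 0 \<le> g k x \<and> g k x \<le> 1"
      "\<And>x. (\<lambda>k. g k x) \<longlonglongrightarrow> indicator (\<Union>m<n. box (a m) (b m)) x"
      using test_fun_approx_finite_union_box[of a b n] by blast
    show ?thesis
    proof (rule lim[of g])
      have "open (\<Union>m<n. box (a m) (b m))" by (auto intro: open_box)
      then show "indicator (\<Union>m<n. box (a m) (b m)) \<in> borel_measurable (lebesgue :: 'a measure)"
        by (intro borel_measurable_indicator) auto
      show "P (g k)" for k
        using g(1,2)[of k] by (intro test) blast+
      show "\<bar>g k x\<bar> \<le> 1" for k x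
        using g(2)[of k x] by linarith
      show "AE x in lebesgue. (\<lambda>k. g k x) \<longlonglongrightarrow> indicator (\<Union>m<n. box (a m) (b m)) x"
        using g(3) by (intro AE_I2)
    qed (intro test_fun_measurable g)
  qed
  have op: "P (indicator S)" if S: "open S" for S
  proof (cases "S = {}")
    case True
    then show ?thesis using un[where n = 0] by simp
  next
    case False
    obtain \<D> where \<D>: "countable \<D>" "\<And>X. X \<in> \<D> \<Longrightarrow> \<exists>a b. X = box a b" "\<Union>\<D> = S"
      using open_countable_Union_open_box[OF S] by metis
    have ne: "\<D> \<noteq> {}" using False \<D>(3) by auto
    have "\<exists>a b. from_nat_into \<D> m = box a b" for m
      using \<D>(2) from_nat_into[OF ne] by blast
    then obtain a b where ab: "\<And>m. from_nat_into \<D> m = box (a m) (b m)"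
      by metis
    have Seq: "S = (\<Union>m. box (a m) (b m))"
      using \<D>(3) range_from_nat_into[OF ne \<D>(1)] unfolding ab by simp
    show ?thesis
    proof (rule lim[of "\<lambda>k. indicator (\<Union>m<k. box (a m) (b m))"])
      show "P (indicator (\<Union>m<k. box (a m) (b m)))" for k
        by (rule un)
      show "indicator (\<Union>m<k. box (a m) (b m)) \<in> borel_measurable (lebesgue :: 'a measure)" for k
        using open_UN[of "{..<k}" "\<lambda>m. box (a m) (b m)"]
        by (intro borel_measurable_indicator) (auto simp: open_box)
      show "indicator S \<in> borel_measurable (lebesgue :: 'a measure)"
        using S by (intro borel_measurable_indicator) auto
      show "\<bar>indicator (\<Union>m<k. box (a m) (b m)) x :: real\<bar> \<le> 1" for k x
        by (simp add: indicator_def)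
      show "AE x in lebesgue. (\<lambda>k. indicator (\<Union>m<k. box (a m) (b m)) x :: real) \<longlonglongrightarrow> indicator S x"
        unfolding Seq by (intro AE_I2 LIMSEQ_indicator_UN)
    qed
  qed
  have "\<exists>U. open U \<and> A \<subseteq> U \<and> emeasure lebesgue (U - A) < ennreal (inverse (real (Suc n)))" for n
  proof -
    have "inverse (real (Suc n)) > 0" by simp
    then obtain U where "open U" "A \<subseteq> U" "emeasure lebesgue (U - A) < ennreal (inverse (real (Suc n)))"
      by (rule sets_lebesgue_outer_open[OF A])
    then show ?thesis by (intro exI conjI)
  qed
  then obtain U where U: "\<And>n. open (U n)" "\<And>n. A \<subseteq> U n"
    "\<And>n. emeasure lebesgue (U n - A) < ennreal (inverse (real (Suc n)))" by metis
  have Us: "(\<Inter>n. U n) - A \<in> sets lebesgue"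
  proof (rule sets.Diff[OF sets.countable_INT A])
    show "range U \<subseteq> sets lebesgue" using U(1) by auto
  qed simp
  have "emeasure lebesgue ((\<Inter>n. U n) - A) \<le> ennreal (inverse (real (Suc n)))" for n
  proof -
    have "emeasure lebesgue ((\<Inter>n. U n) - A) \<le> emeasure lebesgue (U n - A)"
      using U(1) A by (intro emeasure_mono) (auto intro!: sets.Diff)
    also have "\<dots> \<le> ennreal (inverse (real (Suc n)))"
      using U(3)[of n] by (rule less_imp_le)
    finally show ?thesis .
  qed
  moreover have "(\<lambda>n. ennreal (inverse (real (Suc n)))) \<longlonglongrightarrow> ennreal 0"
    by (intro tendsto_ennrealI LIMSEQ_inverse_real_of_nat)
  ultimately have "emeasure lebesgue ((\<Inter>n. U n) - A) \<le> ennreal 0"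
    by (intro LIMSEQ_le_const) auto
  then have "(\<Inter>n. U n) - A \<in> null_sets lebesgue"
    using Us by (simp add: null_sets_def)
  then have ae: "AE x in lebesgue. x \<notin> (\<Inter>n. U n) - A"
    by (rule AE_not_in)
  show ?thesis
  proof (rule lim[of "\<lambda>k. indicator (\<Inter>n<k. U n)"])
    show "P (indicator (\<Inter>n<k. U n))" for k
      using U(1) by (intro op open_INT) auto
    show "indicator (\<Inter>n<k. U n) \<in> borel_measurable (lebesgue :: 'a measure)" for k
      using U(1) open_INT[of "{..<k}" U] by (intro borel_measurable_indicator) auto
    show "AE x in lebesgue. (\<lambda>k. indicator (\<Inter>n<k. U n) x) \<longlonglongrightarrow> (indicator A x :: real)"
      using ae
    proof eventually_elim
      case (elim x)
      then have "indicator (\<Inter>n. U n) x = (indicator A x :: real)"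
        using U(2) by (auto simp: indicator_def)
      then show ?case
        using LIMSEQ_indicator_INT[of U x, where ?'a = real] by simp
    qed
    show "indicator A \<in> borel_measurable lebesgue"
      using A by (rule borel_measurable_indicator)
  qed (simp add: indicator_def)
qed

subsection \<open>Locally integrable functions\<close>

lemma L1loc_measurable: "L1loc w \<Longrightarrow> w \<in> borel_measurable lebesgue"
  by (simp add: L1loc_def)

lemma L1loc_set_integrable:
  "L1loc w \<Longrightarrow> compact K \<Longrightarrow> integrable lebesgue (\<lambda>x. indicator K x * w x)"
  by (simp add: L1loc_def set_integrable_def)

lemma L1locI:
  assumes "w \<in> borel_measurable lebesgue" "\<And>K. compact K \<Longrightarrow> integrable lebesgue (\<lambda>x. indicator K x * w x)"
  shows "L1loc w"
  using assms by (simp add: L1loc_def set_integrable_def)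

lemma integrable_mult_compact_support:
  assumes "L1loc w" "g \<in> borel_measurable lebesgue" "compact K"
    "\<And>x. x \<notin> K \<Longrightarrow> g x = 0" "\<And>x. \<bar>g x\<bar> \<le> M"
  shows "integrable lebesgue (\<lambda>x. w x * g x)"
proof (rule Bochner_Integration.integrable_bound)
  show "integrable lebesgue (\<lambda>x. M * (indicator K x * w x))"
    using assms by (auto intro!: L1loc_set_integrable)
  show "(\<lambda>x. w x * g x) \<in> borel_measurable lebesgue"
    using L1loc_measurable[OF assms(1)] assms(2) by (rule borel_measurable_times)
  show "AE x in lebesgue. norm (w x * g x) \<le> norm (M * (indicator K x * w x))"
  proof (rule AE_I2)
    fix x
    have "\<bar>g x\<bar> \<le> \<bar>M\<bar>" using assms(5)[of x] by linarith
    then show "norm (w x * g x) \<le> norm (M * (indicator K x * w x))"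
      using assms(4)[of x] mult_left_mono[of "\<bar>g x\<bar>" "\<bar>M\<bar>" "\<bar>w x\<bar>"]
      by (cases "x \<in> K") (auto simp: abs_mult mult.commute)
  qed
qed

lemma integrable_mult_test_fun:
  assumes "L1loc w" "test_fun \<phi>"
  shows "integrable lebesgue (\<lambda>x. w x * \<phi> x)"
proof -
  obtain K M where "compact K" "\<And>x. x \<notin> K \<Longrightarrow> \<phi> x = 0" "\<And>x. \<bar>\<phi> x\<bar> \<le> M"
    by (rule test_fun_bounds[OF assms(2) SOME_Basis]) blast
  then show ?thesis
    using assms by (intro integrable_mult_compact_support[of w \<phi> K M] test_fun_measurable)
qed

lemma integrable_mult_partial:
  assumes "L1loc w" "test_fun \<phi>" "i \<in> Basis"
  shows "integrable lebesgue (\<lambda>x. w x * partial \<phi> i x)"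
proof -
  obtain K M where "compact K" "\<And>x. x \<notin> K \<Longrightarrow> partial \<phi> i x = 0" "\<And>x. \<bar>partial \<phi> i x\<bar> \<le> M"
    by (rule test_fun_bounds[OF assms(2,3)]) blast
  then show ?thesis
    using assms by (intro integrable_mult_compact_support[of w _ K M] partial_test_fun_measurable)
qed

lemma L1loc_add: "L1loc v \<Longrightarrow> L1loc w \<Longrightarrow> L1loc (\<lambda>x. v x + w x)"
  by (auto intro!: L1locI borel_measurable_add simp: distrib_left L1loc_measurable L1loc_set_integrable)

lemma L1loc_cmult: "L1loc w \<Longrightarrow> L1loc (\<lambda>x. c * w x)"
  using L1loc_set_integrable[of w]
  by (auto intro!: L1locI borel_measurable_times simp: L1loc_measurable mult.left_commute)

lemma L1loc_diff: "L1loc v \<Longrightarrow> L1loc w \<Longrightarrow> L1loc (\<lambda>x. v x - w x)"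
  using L1loc_add[OF _ L1loc_cmult[of w "-1"]] by simp

lemma L1loc_const: "L1loc (\<lambda>x. c)"
proof (rule L1locI)
  fix K :: "'a set" assume "compact K"
  then have "integrable lebesgue (indicator K :: 'a \<Rightarrow> real)"
    using lmeasurable_compact[of K] by (auto simp: fmeasurable_def)
  then show "integrable lebesgue (\<lambda>x. indicator K x * c)" by simp
qed simp

lemma L1loc_bound:
  assumes "L1loc w" "v \<in> borel_measurable lebesgue" "\<And>x. \<bar>v x\<bar> \<le> \<bar>w x\<bar>"
  shows "L1loc v"
proof (rule L1locI)
  fix K :: "'a set" assume K: "compact K"
  have [measurable]: "K \<in> sets lebesgue" using K lmeasurable_compact by blast
  show "integrable lebesgue (\<lambda>x. indicator K x * v x)"
    by (rule Bochner_Integration.integrable_bound[OF L1loc_set_integrable[OF assms(1) K]])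
      (use assms in \<open>auto simp: indicator_def\<close>)
qed (rule assms)

lemma L1loc_translate:
  fixes w :: "'a::euclidean_space \<Rightarrow> real"
  assumes "L1loc w" shows "L1loc (\<lambda>x. w (x + c))"
proof (rule L1locI)
  fix K :: "'a set" assume "compact K"
  then have "compact ((\<lambda>x. x + c) ` K)"
    by (intro compact_continuous_image continuous_intros)
  from integrable_translate[OF L1loc_set_integrable[OF assms this], of c]
  show "integrable lebesgue (\<lambda>x. indicator K x * w (x + c))"
    by (simp add: indicator_def image_iff)
qed (intro borel_measurable_translate L1loc_measurable assms)

text \<open>Density allows testing with a bump times the indicator of \<open>{q > 0}\<close>. The
  integrand is then nonnegative with integral zero, so \<open>q > 0\<close> can hold only on a null
  set inside the box. The bump makes the weight integrable, as dominated convergence requires;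
  countably many boxes exhaust the space.\<close>

lemma nonpos_AE_if_test_integrals_zero:
  fixes q :: "'a::euclidean_space \<Rightarrow> real"
  assumes q: "L1loc q" and zero: "\<And>\<phi>. test_fun \<phi> \<Longrightarrow> (\<integral>x. q x * \<phi> x \<partial>lebesgue) = 0"
  shows "AE x in lebesgue. q x \<le> 0"
proof -
  note [measurable] = L1loc_measurable[OF q]
  let ?A = "{x. q x > 0}"
  have A: "?A \<in> sets lebesgue"
    using measurable_sets[OF L1loc_measurable[OF q], of "{0<..}"] by (auto simp: vimage_def)
  have "AE x in lebesgue. x \<in> box (- a) a \<longrightarrow> q x \<le> 0" for a :: 'a
  proof -
    let ?\<chi> = "bump (- a) a 0"
    have int: "integrable lebesgue (\<lambda>x. q x * ?\<chi> x)"
      by (intro integrable_mult_test_fun q test_fun_bump)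
    from A have "(\<integral>x. q x * ?\<chi> x * indicator ?A x \<partial>lebesgue) = 0"
    proof (induction rule: test_fun_dense_indicator)
      case (test g)
      then show ?case
        using zero[OF test_fun_mult[OF test_fun_bump[of "-a" a 0] test(1)]] by (simp add: mult.assoc)
    next
      case (lim g h)
      have "(\<lambda>k. \<integral>x. q x * ?\<chi> x * g k x \<partial>lebesgue) \<longlonglongrightarrow> (\<integral>x. q x * ?\<chi> x * h x \<partial>lebesgue)"
      proof (rule integral_dominated_convergence[where w = "\<lambda>x. \<bar>q x * ?\<chi> x\<bar>"])
        show "AE x in lebesgue. (\<lambda>k. q x * ?\<chi> x * g k x) \<longlonglongrightarrow> q x * ?\<chi> x * h x"
          using lim(5) by eventually_elim (intro tendsto_intros)
        show "AE x in lebesgue. norm (q x * ?\<chi> x * g k x) \<le> \<bar>q x * ?\<chi> x\<bar>" for k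
          using mult_left_mono[OF lim(3)[of k]] by (auto simp: abs_mult)
      qed (use int lim in auto)
      then show ?case using lim(1) by (simp add: LIMSEQ_const_iff)
    qed
    moreover have "integrable lebesgue (\<lambda>x. q x * ?\<chi> x * indicator ?A x)"
      using integrable_mult_indicator[OF A int] by (simp add: mult.commute)
    ultimately have "AE x in lebesgue. q x * ?\<chi> x * indicator ?A x = 0"
      by (subst integral_nonneg_eq_0_iff_AE[symmetric])
        (auto simp: indicator_def bump_nonneg)
    then show ?thesis
    proof eventually_elim
      case (elim x)
      show ?case
      proof
        assume "x \<in> box (- a) a"
        then have "?\<chi> x > 0" using bump_pos_iff by blast
        then show "q x \<le> 0" using elim by (auto simp: indicator_def split: if_splits)
      qed
    qed
  qed
  then have "AE x in lebesgue. \<forall>n. x \<in> box (- (real n *\<^sub>R One)) (real n *\<^sub>R (One :: 'a)) \<longrightarrow> q x \<le> 0"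
    by (subst AE_all_countable) blast
  then show ?thesis
  proof eventually_elim
    case (elim x)
    obtain n where n: "norm x < real n" using reals_Archimedean2 by blast
    have "x \<in> box (- (real n *\<^sub>R One)) (real n *\<^sub>R (One :: 'a))"
    proof -
      have "\<bar>x \<bullet> i\<bar> < real n" if "i \<in> Basis" for i
        using Basis_le_norm[OF that, of x] n by linarith
      then show ?thesis by (auto simp: mem_box abs_less_iff minus_less_iff)
    qed
    then show ?case using elim by blast
  qed
qed

lemma fundamental_lemma_variations:
  fixes q :: "'a::euclidean_space \<Rightarrow> real"
  assumes q: "L1loc q" and zero: "\<And>\<phi>. test_fun \<phi> \<Longrightarrow> (\<integral>x. q x * \<phi> x \<partial>lebesgue) = 0"
  shows "AE x in lebesgue. q x = 0"
proof -
  have "AE x in lebesgue. - q x \<le> 0"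
    using L1loc_cmult[OF q, of "-1"] zero by (intro nonpos_AE_if_test_integrals_zero) auto
  moreover have "AE x in lebesgue. q x \<le> 0"
    using assms by (rule nonpos_AE_if_test_integrals_zero)
  ultimately show ?thesis by eventually_elim auto
qed

section \<open>Differentiating integrals against translated test functions\<close>

lemma test_fun_line_derivative:
  assumes "test_fun \<phi>"
  shows "((\<lambda>s. \<phi> (x - s *\<^sub>R i)) has_real_derivative - partial \<phi> i (x - s *\<^sub>R i)) (at s)"
proof -
  let ?D = "frechet_derivative \<phi> (at (x - s *\<^sub>R i))"
  have D: "(\<phi> has_derivative ?D) (at (x - s *\<^sub>R i))"
    using test_fun_differentiable[OF assms] partial_works by blast
  have "((\<lambda>s. x - s *\<^sub>R i) has_derivative (\<lambda>h. - (h *\<^sub>R i))) (at s)"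
    by (auto intro!: derivative_eq_intros)
  from has_derivative_compose[OF this D]
  have "((\<lambda>s. \<phi> (x - s *\<^sub>R i)) has_derivative (\<lambda>h. ?D (- (h *\<^sub>R i)))) (at s)" .
  moreover have "(\<lambda>h. ?D (- (h *\<^sub>R i))) = (*) (- ?D i)"
    using has_derivative_linear[OF D] by (auto simp: linear_neg linear_cmul)
  ultimately show ?thesis
    by (simp only: has_field_derivative_def partial_def)
qed

lemma test_fun_difference_quotient:
  fixes \<phi> :: "'a::euclidean_space \<Rightarrow> real"
  assumes "test_fun \<phi>" "i \<in> Basis"
  obtains K M where "compact K" "\<And>x h. x \<notin> K \<Longrightarrow> \<bar>h\<bar> < 1 \<Longrightarrow> \<phi> (x - h *\<^sub>R i) = 0"
    "\<And>x h. \<bar>\<phi> (x - h *\<^sub>R i) - \<phi> x\<bar> \<le> M * \<bar>h\<bar>"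
proof -
  from test_fun_bounds[OF assms] obtain K M where K: "compact K" "\<And>x. x \<notin> K \<Longrightarrow> \<phi> x = 0"
    "\<And>x. \<bar>partial \<phi> i x\<bar> \<le> M" by metis
  obtain R where R: "\<And>x. x \<in> K \<Longrightarrow> norm x \<le> R"
    using compact_imp_bounded[OF K(1)] by (auto simp: bounded_iff)
  \<comment> \<open>Enlarging the radius by 1 absorbs every shift with
    \<open>\<bar>h\<bar> < 1\<close>, so all these translates share one compact support.\<close>
  have "\<phi> (x - h *\<^sub>R i) = 0" if "x \<notin> cball 0 (R + 1)" "\<bar>h\<bar> < 1" for x h
  proof -
    have "norm x \<le> norm (x - h *\<^sub>R i) + norm (h *\<^sub>R i)"
      by (metis diff_add_cancel norm_triangle_ineq)
    then have "norm (x - h *\<^sub>R i) > R" using that assms(2) by auto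
    then show ?thesis using K(2) R by force
  qed
  moreover have "\<bar>\<phi> (x - h *\<^sub>R i) - \<phi> x\<bar> \<le> M * \<bar>h\<bar>" for x h
    using field_differentiable_bound[of UNIV "\<lambda>s. \<phi> (x - s *\<^sub>R i)" "\<lambda>s. - partial \<phi> i (x - s *\<^sub>R i)" M h 0]
      test_fun_line_derivative[OF assms(1)] K(3) by simp
  ultimately show ?thesis using that[of "cball 0 (R + 1)" M] by auto
qed

text \<open>The translation is put on the smooth factor, so local integrability of \<open>w\<close>
  is enough: the difference quotients of \<open>\<phi>\<close> are uniformly bounded and live on one
  compact set, which gives an integrable majorant.\<close>

lemma DERIV_integral_translate_at_0:
  fixes w :: "'a::euclidean_space \<Rightarrow> real"
  assumes w: "L1loc w" and \<phi>: "test_fun \<phi>" and i: "i \<in> Basis"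
  shows "((\<lambda>s. \<integral>x. w x * \<phi> (x - s *\<^sub>R i) \<partial>lebesgue) has_real_derivative
    - (\<integral>x. w x * partial \<phi> i x \<partial>lebesgue)) (at 0)"
proof -
  let ?\<Psi> = "\<lambda>s. \<integral>x. w x * \<phi> (x - s *\<^sub>R i) \<partial>lebesgue"
  note [measurable] = L1loc_measurable[OF w] test_fun_measurable[OF \<phi>] partial_test_fun_measurable[OF \<phi> i]
  from test_fun_difference_quotient[OF \<phi> i] obtain K M where K: "compact K"
    "\<And>x h. x \<notin> K \<Longrightarrow> \<bar>h\<bar> < 1 \<Longrightarrow> \<phi> (x - h *\<^sub>R i) = 0"
    "\<And>x h. \<bar>\<phi> (x - h *\<^sub>R i) - \<phi> x\<bar> \<le> M * \<bar>h\<bar>" by metis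
  have tf: "test_fun (\<lambda>x. \<phi> (x - s *\<^sub>R i))" for s
    using test_fun_translate[OF \<phi>, of "- (s *\<^sub>R i)"] by simp
  \<comment> \<open>Restricting to the unit ball keeps the increments below 1 along every sequence,
    as the common support demands. The ball is open, so the limit is the one at 0.\<close>
  have "((\<lambda>h. (?\<Psi> h - ?\<Psi> 0) / h) \<longlongrightarrow> - (\<integral>x. w x * partial \<phi> i x \<partial>lebesgue)) (at 0 within ball 0 1)"
    unfolding tendsto_at_iff_sequentially
  proof (intro allI impI)
    fix X :: "nat \<Rightarrow> real"
    assume X: "\<forall>k. X k \<in> ball 0 1 - {0}" "X \<longlonglongrightarrow> 0"
    then have X': "\<And>k. X k \<noteq> 0" "\<And>k. \<bar>X k\<bar> < 1" by auto
    let ?d = "\<lambda>k x. w x * ((\<phi> (x - X k *\<^sub>R i) - \<phi> x) / X k)"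
    have "(\<lambda>k. \<integral>x. ?d k x \<partial>lebesgue) \<longlonglongrightarrow> (\<integral>x. w x * (- partial \<phi> i x) \<partial>lebesgue)"
    proof (rule integral_dominated_convergence[where w = "\<lambda>x. \<bar>M * (indicator K x * w x)\<bar>"])
      show "integrable lebesgue (\<lambda>x. \<bar>M * (indicator K x * w x)\<bar>)"
        using K(1) w by (auto intro!: L1loc_set_integrable)
      show "AE x in lebesgue. (\<lambda>k. ?d k x) \<longlonglongrightarrow> w x * (- partial \<phi> i x)"
      proof (rule AE_I2)
        fix x
        have "((\<lambda>h. (\<phi> (x - h *\<^sub>R i) - \<phi> x) / h) \<longlongrightarrow> - partial \<phi> i x) (at 0)"
          using test_fun_line_derivative[OF \<phi>, of x i 0] by (simp add: has_field_derivative_iff)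
        then have "(\<lambda>k. (\<phi> (x - X k *\<^sub>R i) - \<phi> x) / X k) \<longlonglongrightarrow> - partial \<phi> i x"
          using X(2) X'(1) by (auto simp: tendsto_at_iff_sequentially comp_def)
        then show "(\<lambda>k. ?d k x) \<longlonglongrightarrow> w x * (- partial \<phi> i x)"
          by (intro tendsto_intros)
      qed
      show "AE x in lebesgue. norm (?d k x) \<le> \<bar>M * (indicator K x * w x)\<bar>" for k
      proof (rule AE_I2)
        fix x
        show "norm (?d k x) \<le> \<bar>M * (indicator K x * w x)\<bar>"
        proof (cases "x \<in> K")
          case True
          have "\<bar>(\<phi> (x - X k *\<^sub>R i) - \<phi> x) / X k\<bar> \<le> \<bar>M\<bar>"
            using K(3)[of x "X k"] X'(1)[of k] by (simp add: abs_divide divide_le_eq)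
              (metis abs_ge_self abs_ge_zero dual_order.trans mult_right_mono)
          from mult_left_mono[OF this, of "\<bar>w x\<bar>"] show ?thesis
            using True by (simp add: abs_mult mult.commute)
        next
          case False
          then show ?thesis using K(2)[of x "X k"] K(2)[of x 0] X'(2)[of k] by simp
        qed
      qed
      show "?d k \<in> borel_measurable lebesgue" for k
        using test_fun_measurable[OF tf[of "X k"]] by measurable
    qed measurable
    moreover have "(\<integral>x. ?d k x \<partial>lebesgue) = (?\<Psi> (X k) - ?\<Psi> 0) / X k" for k
    proof -
      have "(?\<Psi> (X k) - ?\<Psi> 0) = (\<integral>x. w x * \<phi> (x - X k *\<^sub>R i) - w x * \<phi> x \<partial>lebesgue)"
        using integrable_mult_test_fun[OF w tf[of "X k"]] integrable_mult_test_fun[OF w \<phi>] by simp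
      also have "\<dots> = (\<integral>x. ?d k x * X k \<partial>lebesgue)"
        using X'(1) by (intro Bochner_Integration.integral_cong) (auto simp: right_diff_distrib[symmetric])
      finally show ?thesis using X'(1)[of k] by simp
    qed
    ultimately have "(\<lambda>k. (?\<Psi> (X k) - ?\<Psi> 0) / X k) \<longlonglongrightarrow> (\<integral>x. w x * (- partial \<phi> i x) \<partial>lebesgue)"
      by (simp only:)
    then show "((\<lambda>h. (?\<Psi> h - ?\<Psi> 0) / h) \<circ> X) \<longlonglongrightarrow> - (\<integral>x. w x * partial \<phi> i x \<partial>lebesgue)"
      by (simp add: comp_def)
  qed
  then show ?thesis
    by (simp add: has_field_derivative_iff at_within_open[of 0 "ball 0 1"])
qed

lemma DERIV_integral_translate:
  fixes w :: "'a::euclidean_space \<Rightarrow> real"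
  assumes w: "L1loc w" and \<phi>: "test_fun \<phi>" and i: "i \<in> Basis"
  shows "((\<lambda>s. \<integral>x. w x * \<phi> (x - s *\<^sub>R i) \<partial>lebesgue) has_real_derivative
    - (\<integral>x. w x * partial \<phi> i (x - s *\<^sub>R i) \<partial>lebesgue)) (at s)"
proof -
  have tf: "test_fun (\<lambda>x. \<phi> (x - s *\<^sub>R i))"
    using test_fun_translate[OF \<phi>, of "- (s *\<^sub>R i)"] by simp
  have p: "partial (\<lambda>x. \<phi> (x - s *\<^sub>R i)) i x = partial \<phi> i (x - s *\<^sub>R i)" for x
    using partial_translate[of \<phi> "- (s *\<^sub>R i)" i x] by simp
  have "((\<lambda>r. \<integral>x. w x * \<phi> (x - r *\<^sub>R i - s *\<^sub>R i) \<partial>lebesgue) has_real_derivative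
    - (\<integral>x. w x * partial \<phi> i (x - s *\<^sub>R i) \<partial>lebesgue)) (at (s - s))"
    using DERIV_integral_translate_at_0[OF w tf i] by (simp add: p)
  from DERIV_shift[THEN iffD1, of "\<lambda>r. \<integral>x. w x * \<phi> (x - r *\<^sub>R i - s *\<^sub>R i) \<partial>lebesgue" _ s "- s"] this
  show ?thesis by (simp add: algebra_simps)
qed

subsection \<open>Weak partial derivatives\<close>

text \<open>A single direction is isolated because shifts and difference quotients act along one
  basis vector at a time; gradients are reassembled coordinatewise.\<close>

definition weak_partial :: "'a::euclidean_space \<Rightarrow> ('a \<Rightarrow> real) \<Rightarrow> ('a \<Rightarrow> real) \<Rightarrow> bool" where
  "weak_partial i w g \<longleftrightarrow> L1loc w \<and> L1loc g \<and>
     (\<forall>\<phi>. test_fun \<phi> \<longrightarrow> (\<integral>x. w x * partial \<phi> i x \<partial>lebesgue) = - (\<integral>x. g x * \<phi> x \<partial>lebesgue))"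

lemma is_weak_grad_iff: "is_weak_grad w G \<longleftrightarrow> (\<forall>i\<in>Basis. weak_partial i w (\<lambda>x. G x \<bullet> i))"
  using SOME_Basis unfolding is_weak_grad_def weak_partial_def by blast

lemma weak_partialD:
  assumes "weak_partial i w g"
  shows "L1loc w" "L1loc g"
    "test_fun \<phi> \<Longrightarrow> (\<integral>x. w x * partial \<phi> i x \<partial>lebesgue) = - (\<integral>x. g x * \<phi> x \<partial>lebesgue)"
  using assms by (auto simp: weak_partial_def)

text \<open>For a test function \<open>\<eta>\<close>, the mean value theorem applied to \<open>s \<mapsto> \<integral> w(x) \<eta>(x - s i) dx\<close> shows that testing
  the difference quotient of \<open>w\<close> with \<open>\<eta>\<close> is the same as testing a small translate of \<open>g\<close>. The resulting
  bound depends on \<open>\<eta>\<close> only through its supremum and support, so it survives the passage to \<open>\<phi> 1\<^sub>A\<close>.\<close>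

lemma difference_quotient_tendsto:
  fixes w :: "'a::euclidean_space \<Rightarrow> real"
  assumes w: "weak_partial i w g" and i: "i \<in> Basis" and \<phi>: "test_fun \<phi>" and A: "A \<in> sets lebesgue"
  shows "((\<lambda>h. \<integral>x. (w (x + h *\<^sub>R i) - w x) / h * \<phi> x * indicator A x \<partial>lebesgue)
    \<longlongrightarrow> (\<integral>x. g x * \<phi> x * indicator A x \<partial>lebesgue)) (at 0)"
proof (rule tendstoI)
  fix e :: real assume "e > 0"
  note L = weak_partialD(1)[OF w] weak_partialD(2)[OF w]
  note wm = L1loc_measurable[OF L(1)]
  note gm = L1loc_measurable[OF L(2)]
  obtain K M where K: "compact K" "M > 0" "\<And>x. x \<notin> K \<Longrightarrow> \<phi> x = 0" "\<And>x. \<bar>\<phi> x\<bar> \<le> M"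
    by (rule test_fun_bounds[OF \<phi> i]) blast
  obtain R where R: "\<And>x. x \<in> K \<Longrightarrow> norm x \<le> R"
    using compact_imp_bounded[OF K(1)] by (auto simp: bounded_iff)
  \<comment> \<open>Points of \<open>K\<close> moved by less than 1 stay in this ball. Cutting
    \<open>g\<close> off outside it gives an integrable function, to which continuity of
    translations applies, without altering the values that matter.\<close>
  let ?B = "cball 0 (R + 1) :: 'a set"
  let ?g = "\<lambda>x. indicator ?B x * g x"
  have intg: "integrable lebesgue ?g"
    by (intro L1loc_set_integrable L compact_cball)
  \<comment> \<open>A test function bounded by \<open>M\<close> turns this shift error into
    \<open>e / 2\<close>. The half leaves room for a strict inequality at the end, since only the
    nonstrict estimate survives the limit.\<close>
  have "e / 2 / M > 0" using \<open>e > 0\<close> K(2) by simp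
  from L1_translation_continuous[OF intg this]
  obtain d where d: "d > 0" "\<And>c. norm c < d \<Longrightarrow> (\<integral>x. \<bar>?g (x + c) - ?g x\<bar> \<partial>lebesgue) \<le> e / 2 / M"
    by blast
  let ?D = "\<lambda>h x. (w (x + h *\<^sub>R i) - w x) / h"
  have est: "\<bar>(\<integral>x. ?D h x * \<phi> x * indicator A x \<partial>lebesgue) - (\<integral>x. g x * \<phi> x * indicator A x \<partial>lebesgue)\<bar> \<le> e / 2"
    if h: "h \<noteq> 0" "\<bar>h\<bar> < min d 1" for h
  proof -
    have LD: "L1loc (?D h)"
      using L1loc_cmult[OF L1loc_diff[OF L1loc_translate[OF L(1), of "h *\<^sub>R i"] L(1)], of "1 / h"] by simp
    have int: "integrable lebesgue (\<lambda>x. ?D h x * \<phi> x)" "integrable lebesgue (\<lambda>x. g x * \<phi> x)"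
      by (intro integrable_mult_test_fun LD L \<phi>)+
    from A show ?thesis
    proof (induction rule: test_fun_dense_indicator)
      case (test \<psi>)
      let ?\<eta> = "\<lambda>x. \<phi> x * \<psi> x"
      have \<eta>: "test_fun ?\<eta>" by (intro test_fun_mult \<phi> test)
      have \<eta>M: "\<bar>?\<eta> x\<bar> \<le> M" for x
        using mult_mono[OF K(4)[of x] test(3)[of x]] test(2)[of x] K(2) by (simp add: abs_mult)
      have tr: "test_fun (\<lambda>x. ?\<eta> (x - s *\<^sub>R i))" for s
        using test_fun_translate[OF \<eta>, of "- (s *\<^sub>R i)"] by simp
      have shift: "(\<integral>x. v x * ?\<eta> (x - s *\<^sub>R i) \<partial>lebesgue) = (\<integral>x. v (x + s *\<^sub>R i) * ?\<eta> x \<partial>lebesgue)"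
        if "L1loc v" for v s
        using integral_translate[OF borel_measurable_integrable[OF integrable_mult_test_fun[OF that tr[of s]]], of "s *\<^sub>R i"]
        by simp
      let ?\<Psi> = "\<lambda>s. \<integral>x. w x * ?\<eta> (x - s *\<^sub>R i) \<partial>lebesgue"
      \<comment> \<open>The derivative falls on the translated test function, and weak
        differentiability against that same function moves it onto \<open>w\<close>; the two minus
        signs cancel.\<close>
      have \<Psi>': "(?\<Psi> has_real_derivative (\<integral>x. g (x + s *\<^sub>R i) * ?\<eta> x \<partial>lebesgue)) (at s)" for s
      proof -
        have p: "partial (\<lambda>x. ?\<eta> (x - s *\<^sub>R i)) i x = partial ?\<eta> i (x - s *\<^sub>R i)" for x
          using partial_translate[of ?\<eta> "- (s *\<^sub>R i)" i x] by simp
        show ?thesis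
          using DERIV_integral_translate[OF L(1) \<eta> i, of s] weak_partialD(3)[OF w tr[of s]] shift[OF L(2), of s]
          by (simp add: p)
      qed
      obtain \<xi> where \<xi>: "\<bar>\<xi>\<bar> < \<bar>h\<bar>" "?\<Psi> h - ?\<Psi> 0 = h * (\<integral>x. g (x + \<xi> *\<^sub>R i) * ?\<eta> x \<partial>lebesgue)"
      proof (cases "h > 0")
        case True
        from MVT2[OF True, of ?\<Psi> "\<lambda>s. \<integral>x. g (x + s *\<^sub>R i) * ?\<eta> x \<partial>lebesgue"] \<Psi>'
        show ?thesis using that by force
      next
        case False
        then have "h < 0" using h by simp
        from MVT2[OF this, of ?\<Psi> "\<lambda>s. \<integral>x. g (x + s *\<^sub>R i) * ?\<eta> x \<partial>lebesgue"] \<Psi>'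
        obtain z where "h < z" "z < 0" "?\<Psi> 0 - ?\<Psi> h = (0 - h) * (\<integral>x. g (x + z *\<^sub>R i) * ?\<eta> x \<partial>lebesgue)"
          by blast
        then show ?thesis using that[of z] \<open>h < 0\<close> by (simp add: algebra_simps)
      qed
      have "(\<integral>x. ?D h x * ?\<eta> x \<partial>lebesgue) = (\<integral>x. (w (x + h *\<^sub>R i) * ?\<eta> x - w x * ?\<eta> x) / h \<partial>lebesgue)"
        by (intro Bochner_Integration.integral_cong) (auto simp: algebra_simps diff_divide_distrib)
      also have "\<dots> = (?\<Psi> h - ?\<Psi> 0) / h"
        using integrable_mult_test_fun[OF L(1) \<eta>] integrable_mult_test_fun[OF L1loc_translate[OF L(1)] \<eta>] shift[OF L(1), of h]
        by simp
      also have "\<dots> = (\<integral>x. g (x + \<xi> *\<^sub>R i) * ?\<eta> x \<partial>lebesgue)"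
        using \<xi>(2) h(1) by simp
      finally have "\<bar>(\<integral>x. ?D h x * ?\<eta> x \<partial>lebesgue) - (\<integral>x. g x * ?\<eta> x \<partial>lebesgue)\<bar>
          = \<bar>\<integral>x. (g (x + \<xi> *\<^sub>R i) - g x) * ?\<eta> x \<partial>lebesgue\<bar>"
        using integrable_mult_test_fun[OF L(2) \<eta>] integrable_mult_test_fun[OF L1loc_translate[OF L(2)] \<eta>]
        by (simp add: left_diff_distrib)
      also have "\<dots> \<le> (\<integral>x. M * \<bar>?g (x + \<xi> *\<^sub>R i) - ?g x\<bar> \<partial>lebesgue)"
      proof (rule order_trans[OF integral_abs_bound integral_mono'])
        show "integrable lebesgue (\<lambda>x. M * \<bar>?g (x + \<xi> *\<^sub>R i) - ?g x\<bar>)"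
          by (intro integrable_mult_right integrable_abs Bochner_Integration.integrable_diff integrable_translate intg)
        fix x
        show "\<bar>(g (x + \<xi> *\<^sub>R i) - g x) * ?\<eta> x\<bar> \<le> M * \<bar>?g (x + \<xi> *\<^sub>R i) - ?g x\<bar>"
        proof (cases "x \<in> K")
          case True
          have "norm (x + \<xi> *\<^sub>R i) \<le> R + 1"
            using norm_triangle_ineq[of x "\<xi> *\<^sub>R i"] R[OF True] \<xi>(1) h(2) i by simp
          then have eq: "?g (x + \<xi> *\<^sub>R i) = g (x + \<xi> *\<^sub>R i)" "?g x = g x"
            using R[OF True] by auto
          show ?thesis
            unfolding eq abs_mult[of _ "?\<eta> x"] mult.commute[of _ "\<bar>?\<eta> x\<bar>"]
            by (rule mult_right_mono[OF \<eta>M abs_ge_zero])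
        next
          case False
          then show ?thesis using K(2,3) by simp
        qed
        show "0 \<le> M * \<bar>?g (x + \<xi> *\<^sub>R i) - ?g x\<bar>" using K(2) by simp
      qed
      also have "\<dots> \<le> M * (e / 2 / M)"
      proof -
        have "norm (\<xi> *\<^sub>R i) < d" using \<xi>(1) h(2) i by simp
        from mult_left_mono[OF d(2)[OF this], of M] show ?thesis using K(2) by simp
      qed
      finally show ?case
        using K(2) by (simp add: mult.assoc)
    next
      case (lim \<psi> \<psi>')
      have conv: "(\<lambda>k. \<integral>x. q x * \<psi> k x \<partial>lebesgue) \<longlonglongrightarrow> (\<integral>x. q x * \<psi>' x \<partial>lebesgue)"
        if q: "integrable lebesgue q" for q
      proof (rule integral_dominated_convergence[where w = "\<lambda>x. \<bar>q x\<bar>"])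
        show "AE x in lebesgue. (\<lambda>k. q x * \<psi> k x) \<longlonglongrightarrow> q x * \<psi>' x"
          using lim(5) by eventually_elim (intro tendsto_intros)
        show "AE x in lebesgue. norm (q x * \<psi> k x) \<le> \<bar>q x\<bar>" for k
          using mult_left_mono[OF lim(3)[of k]] by (auto simp: abs_mult)
      qed (use q lim in auto)
      have "(\<lambda>k. \<bar>(\<integral>x. ?D h x * \<phi> x * \<psi> k x \<partial>lebesgue) - (\<integral>x. g x * \<phi> x * \<psi> k x \<partial>lebesgue)\<bar>)
          \<longlonglongrightarrow> \<bar>(\<integral>x. ?D h x * \<phi> x * \<psi>' x \<partial>lebesgue) - (\<integral>x. g x * \<phi> x * \<psi>' x \<partial>lebesgue)\<bar>"
        by (intro tendsto_intros conv int)
      then show ?case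
        by (rule LIMSEQ_le_const2) (use lim(1) in auto)
    qed
  qed
  show "\<forall>\<^sub>F h in at 0. dist (\<integral>x. ?D h x * \<phi> x * indicator A x \<partial>lebesgue) (\<integral>x. g x * \<phi> x * indicator A x \<partial>lebesgue) < e"
    unfolding eventually_at
  proof (intro exI[of _ "min d 1"] conjI ballI impI)
    fix h :: real assume "h \<noteq> 0 \<and> dist h 0 < min d 1"
    then have "h \<noteq> 0" "\<bar>h\<bar> < min d 1" by auto
    from est[OF this] show "dist (\<integral>x. ?D h x * \<phi> x * indicator A x \<partial>lebesgue) (\<integral>x. g x * \<phi> x * indicator A x \<partial>lebesgue) < e"
      using \<open>e > 0\<close> by (simp add: dist_real_def)
  qed (use d in auto)
qed

section \<open>The positive part of a weakly differentiable function\<close>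

lemma partial_add:
  assumes "f differentiable (at x)" "g differentiable (at x)"
  shows "partial (\<lambda>x. f x + g x) i x = partial f i x + partial g i x"
  using has_derivative_add[OF partial_works[OF assms(1)] partial_works[OF assms(2)]]
  unfolding partial_def[of f] partial_def[of g] by (rule partial_eqI)

text \<open>The conditions on \<open>A\<close> say that its indicator selects, at each point, a
  subgradient of \<open>max (.) 0\<close> at \<open>w x\<close>: the value 1 is allowed where
  \<open>w \<ge> 0\<close>, the value 0 where \<open>w \<le> 0\<close>. The sign of
  \<open>\<phi>\<close> lets the pointwise subgradient inequality be integrated.\<close>

lemma weak_partial_positive_part_nonneg:
  fixes w :: "'a::euclidean_space \<Rightarrow> real"
  assumes w: "weak_partial i w g" and i: "i \<in> Basis" and A: "A \<in> sets lebesgue"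
    and A1: "\<And>x. x \<in> A \<Longrightarrow> w x \<ge> 0" and A2: "\<And>x. x \<notin> A \<Longrightarrow> w x \<le> 0"
    and \<phi>: "test_fun \<phi>" and nn: "\<And>x. \<phi> x \<ge> 0"
  shows "(\<integral>x. max (w x) 0 * partial \<phi> i x \<partial>lebesgue) = - (\<integral>x. g x * \<phi> x * indicator A x \<partial>lebesgue)"
proof -
  note L = weak_partialD(1)[OF w]
  let ?F = "\<lambda>x. max (w x) 0"
  let ?D = "\<lambda>v h x. (v (x + h *\<^sub>R i) - v x) / h"
  have LF: "L1loc ?F"
    using L borel_measurable_max[OF borel_measurable_const L1loc_measurable[OF L]]
    by (rule L1loc_bound) auto
  have tr: "test_fun (\<lambda>x. \<phi> (x - s *\<^sub>R i))" for s
    using test_fun_translate[OF \<phi>, of "- (s *\<^sub>R i)"] by simp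
  have LD: "L1loc (?D v h)" if "L1loc v" for v h
    using L1loc_cmult[OF L1loc_diff[OF L1loc_translate[OF that, of "h *\<^sub>R i"] that], of "1 / h"] by simp
  have intF: "integrable lebesgue (\<lambda>x. ?D ?F h x * \<phi> x)" for h
    by (intro integrable_mult_test_fun LD LF \<phi>)
  have intw: "integrable lebesgue (\<lambda>x. ?D w h x * \<phi> x * indicator A x)" for h
    using integrable_mult_indicator[OF A integrable_mult_test_fun[OF LD[OF L] \<phi>]] by (simp add: mult.commute)
  \<comment> \<open>Of the positive part only local integrability is known so far, so its difference
    quotients are shifted onto the test function before taking the limit.\<close>
  have limF: "((\<lambda>h. \<integral>x. ?D ?F h x * \<phi> x \<partial>lebesgue) \<longlongrightarrow> - (\<integral>x. ?F x * partial \<phi> i x \<partial>lebesgue)) (at 0)"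
  proof -
    let ?\<Psi> = "\<lambda>s. \<integral>x. ?F x * \<phi> (x - s *\<^sub>R i) \<partial>lebesgue"
    have shift: "?\<Psi> s = (\<integral>x. ?F (x + s *\<^sub>R i) * \<phi> x \<partial>lebesgue)" for s
      using integral_translate[OF borel_measurable_integrable[OF integrable_mult_test_fun[OF LF tr[of s]]], of "s *\<^sub>R i"]
      by simp
    have eq: "(\<integral>x. ?D ?F h x * \<phi> x \<partial>lebesgue) = (?\<Psi> h - ?\<Psi> 0) / h" for h
    proof -
      have "(\<integral>x. ?D ?F h x * \<phi> x \<partial>lebesgue) = (\<integral>x. (?F (x + h *\<^sub>R i) * \<phi> x - ?F x * \<phi> x) / h \<partial>lebesgue)"
        by (intro Bochner_Integration.integral_cong) (auto simp: algebra_simps diff_divide_distrib)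
      also have "\<dots> = (?\<Psi> h - ?\<Psi> 0) / h"
        using integrable_mult_test_fun[OF LF \<phi>] integrable_mult_test_fun[OF L1loc_translate[OF LF] \<phi>] shift[of h]
        by simp
      finally show ?thesis .
    qed
    show ?thesis
      unfolding eq using DERIV_integral_translate_at_0[OF LF \<phi> i]
      by (simp only: has_field_derivative_iff diff_zero)
  qed
  note limw = difference_quotient_tendsto[OF w i \<phi> A]
  have conv: "?F y - ?F x \<ge> indicator A x * (w y - w x)" for x y
    using A1[of x] A2[of x] by (cases "x \<in> A") auto
  have right: "(\<integral>x. ?D w h x * \<phi> x * indicator A x \<partial>lebesgue) \<le> (\<integral>x. ?D ?F h x * \<phi> x \<partial>lebesgue)" if "h > 0" for h
  proof (rule integral_mono[OF intw intF])
    fix x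
    have "indicator A x * (w (x + h *\<^sub>R i) - w x) / h \<le> ?D ?F h x"
      using conv that by (intro divide_right_mono) auto
    from mult_right_mono[OF this nn[of x]]
    show "?D w h x * \<phi> x * indicator A x \<le> ?D ?F h x * \<phi> x"
      by (simp add: mult.commute mult.left_commute)
  qed
  have left: "(\<integral>x. ?D ?F h x * \<phi> x \<partial>lebesgue) \<le> (\<integral>x. ?D w h x * \<phi> x * indicator A x \<partial>lebesgue)" if "h < 0" for h
  proof (rule integral_mono[OF intF intw])
    fix x
    have "?D ?F h x \<le> indicator A x * (w (x + h *\<^sub>R i) - w x) / h"
      using conv that by (intro divide_right_mono_neg) auto
    from mult_right_mono[OF this nn[of x]]
    show "?D ?F h x * \<phi> x \<le> ?D w h x * \<phi> x * indicator A x"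
      by (simp add: mult.commute mult.left_commute)
  qed
  have "(\<integral>x. g x * \<phi> x * indicator A x \<partial>lebesgue) \<le> - (\<integral>x. ?F x * partial \<phi> i x \<partial>lebesgue)"
  proof (rule tendsto_le)
    show "((\<lambda>h. \<integral>x. ?D ?F h x * \<phi> x \<partial>lebesgue) \<longlongrightarrow> - (\<integral>x. ?F x * partial \<phi> i x \<partial>lebesgue)) (at_right 0)"
      using limF by (rule tendsto_within_subset) auto
    show "((\<lambda>h. \<integral>x. ?D w h x * \<phi> x * indicator A x \<partial>lebesgue) \<longlongrightarrow> (\<integral>x. g x * \<phi> x * indicator A x \<partial>lebesgue)) (at_right 0)"
      using limw by (rule tendsto_within_subset) auto
    show "\<forall>\<^sub>F h in at_right 0. (\<integral>x. ?D w h x * \<phi> x * indicator A x \<partial>lebesgue) \<le> (\<integral>x. ?D ?F h x * \<phi> x \<partial>lebesgue)"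
      using right eventually_at_right_less[of "0::real"] by (auto elim!: eventually_mono)
  qed simp
  moreover have "- (\<integral>x. ?F x * partial \<phi> i x \<partial>lebesgue) \<le> (\<integral>x. g x * \<phi> x * indicator A x \<partial>lebesgue)"
  proof (rule tendsto_le)
    show "((\<lambda>h. \<integral>x. ?D ?F h x * \<phi> x \<partial>lebesgue) \<longlongrightarrow> - (\<integral>x. ?F x * partial \<phi> i x \<partial>lebesgue)) (at_left 0)"
      using limF by (rule tendsto_within_subset) auto
    show "((\<lambda>h. \<integral>x. ?D w h x * \<phi> x * indicator A x \<partial>lebesgue) \<longlongrightarrow> (\<integral>x. g x * \<phi> x * indicator A x \<partial>lebesgue)) (at_left 0)"
      using limw by (rule tendsto_within_subset) auto
    show "\<forall>\<^sub>F h in at_left 0. (\<integral>x. ?D ?F h x * \<phi> x \<partial>lebesgue) \<le> (\<integral>x. ?D w h x * \<phi> x * indicator A x \<partial>lebesgue)"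
      using left by (auto simp: eventually_at_filter)
  qed simp
  ultimately show ?thesis by simp
qed

text \<open>The sign restriction is removed by writing \<open>\<phi>\<close> as
  \<open>(\<phi> + \<rho>) - \<rho>\<close> with a test function
  \<open>\<rho> \<ge> \<bar>\<phi>\<bar>\<close>; both terms are nonnegative and smooth.\<close>

lemma weak_partial_positive_part:
  fixes w :: "'a::euclidean_space \<Rightarrow> real"
  assumes w: "weak_partial i w g" and i: "i \<in> Basis" and A: "A \<in> sets lebesgue"
    and A1: "\<And>x. x \<in> A \<Longrightarrow> w x \<ge> 0" and A2: "\<And>x. x \<notin> A \<Longrightarrow> w x \<le> 0"
  shows "weak_partial i (\<lambda>x. max (w x) 0) (\<lambda>x. indicator A x * g x)"
  unfolding weak_partial_def
proof (intro conjI allI impI)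
  note L = weak_partialD(1)[OF w] weak_partialD(2)[OF w]
  show LF: "L1loc (\<lambda>x. max (w x) 0)"
    using L(1) borel_measurable_max[OF borel_measurable_const L1loc_measurable[OF L(1)]]
    by (rule L1loc_bound) auto
  show Lg: "L1loc (\<lambda>x. indicator A x * g x)"
    using L(2) borel_measurable_times[OF borel_measurable_indicator[OF A] L1loc_measurable[OF L(2)]]
    by (rule L1loc_bound) (auto simp: indicator_def)
  fix \<phi> :: "'a \<Rightarrow> real" assume \<phi>: "test_fun \<phi>"
  obtain \<rho> where \<rho>: "test_fun \<rho>" "\<And>x. \<bar>\<phi> x\<bar> \<le> \<rho> x"
    by (rule test_fun_dominated[OF \<phi>]) blast
  have nn: "\<phi> x + \<rho> x \<ge> 0" "\<rho> x \<ge> 0" for x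
    using \<rho>(2)[of x] by linarith+
  note P = weak_partial_positive_part_nonneg[OF w i A A1 A2]
  have p: "partial (\<lambda>x. \<phi> x + \<rho> x) i x = partial \<phi> i x + partial \<rho> i x" for x
    by (intro partial_add test_fun_differentiable \<phi> \<rho>)
  have "(\<integral>x. max (w x) 0 * (partial \<phi> i x + partial \<rho> i x) \<partial>lebesgue)
      = - (\<integral>x. g x * (\<phi> x + \<rho> x) * indicator A x \<partial>lebesgue)"
    using P[OF _ _ test_fun_add[OF \<phi> \<rho>(1)]] nn by (simp add: p)
  moreover have "(\<integral>x. max (w x) 0 * partial \<rho> i x \<partial>lebesgue) = - (\<integral>x. g x * \<rho> x * indicator A x \<partial>lebesgue)"
    using P[OF _ _ \<rho>(1)] nn by simp
  moreover have "(\<integral>x. max (w x) 0 * (partial \<phi> i x + partial \<rho> i x) \<partial>lebesgue)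
      = (\<integral>x. max (w x) 0 * partial \<phi> i x \<partial>lebesgue) + (\<integral>x. max (w x) 0 * partial \<rho> i x \<partial>lebesgue)"
    using integrable_mult_partial[OF LF \<phi> i] integrable_mult_partial[OF LF \<rho>(1) i]
    by (simp add: distrib_left)
  moreover have "(\<integral>x. g x * (\<phi> x + \<rho> x) * indicator A x \<partial>lebesgue)
      = (\<integral>x. indicator A x * g x * \<phi> x \<partial>lebesgue) + (\<integral>x. g x * \<rho> x * indicator A x \<partial>lebesgue)"
    using integrable_mult_test_fun[OF Lg \<phi>] integrable_mult_test_fun[OF Lg \<rho>(1)]
    by (simp add: algebra_simps)
  ultimately show "(\<integral>x. max (w x) 0 * partial \<phi> i x \<partial>lebesgue) = - (\<integral>x. indicator A x * g x * \<phi> x \<partial>lebesgue)"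
    by simp
qed

section \<open>Rules, uniqueness and truncation for weak partial derivatives\<close>

lemma weak_partial_add:
  assumes "weak_partial i v f" "weak_partial i w g" "i \<in> Basis"
  shows "weak_partial i (\<lambda>x. v x + w x) (\<lambda>x. f x + g x)"
proof -
  note L = weak_partialD(1,2)[OF assms(1)] weak_partialD(1,2)[OF assms(2)]
  show ?thesis
    using weak_partialD(3)[OF assms(1)] weak_partialD(3)[OF assms(2)]
      integrable_mult_partial[OF L(1) _ assms(3)] integrable_mult_partial[OF L(3) _ assms(3)]
      integrable_mult_test_fun[OF L(2)] integrable_mult_test_fun[OF L(4)]
    unfolding weak_partial_def by (auto simp: distrib_right intro!: L1loc_add L)
qed

lemma weak_partial_cmult:
  assumes "weak_partial i v f"
  shows "weak_partial i (\<lambda>x. c * v x) (\<lambda>x. c * f x)"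
  using assms unfolding weak_partial_def by (auto simp: mult.assoc intro!: L1loc_cmult)

lemma weak_partial_diff:
  assumes "weak_partial i v f" "weak_partial i w g" "i \<in> Basis"
  shows "weak_partial i (\<lambda>x. v x - w x) (\<lambda>x. f x - g x)"
  using weak_partial_add[OF assms(1) weak_partial_cmult[OF assms(2), of "-1"] assms(3)] by simp

text \<open>By translation invariance \<open>s \<mapsto> \<integral> c * \<phi> (x - s i)\<close> is
  constant, while its derivative at 0 is minus the integral in question.\<close>

lemma weak_partial_const:
  fixes i :: "'a::euclidean_space"
  assumes "i \<in> Basis" shows "weak_partial i (\<lambda>x. c) (\<lambda>x. 0)"
  unfolding weak_partial_def
proof (intro conjI allI impI L1loc_const)
  fix \<phi> :: "'a \<Rightarrow> real" assume \<phi>: "test_fun \<phi>"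
  have "(\<integral>x. c * \<phi> (x - s *\<^sub>R i) \<partial>lebesgue) = (\<integral>x. c * \<phi> x \<partial>lebesgue)" for s
    using integral_translate[OF test_fun_measurable[OF test_fun_cmult[OF \<phi>]], of c "- (s *\<^sub>R i)"] by simp
  then have "((\<lambda>s. \<integral>x. c * \<phi> x \<partial>lebesgue) has_real_derivative - (\<integral>x. c * partial \<phi> i x \<partial>lebesgue)) (at 0)"
    using DERIV_integral_translate_at_0[OF L1loc_const[of c] \<phi> assms] by (simp only:)
  from DERIV_unique[OF this DERIV_const]
  show "(\<integral>x. c * partial \<phi> i x \<partial>lebesgue) = - (\<integral>x. 0 * \<phi> x \<partial>lebesgue)" by simp
qed

lemma weak_partial_unique:
  assumes "weak_partial i v f" "weak_partial i w g" and vw: "AE x in lebesgue. v x = w x" and i: "i \<in> Basis"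
  shows "AE x in lebesgue. f x = g x"
proof -
  note L = weak_partialD(1,2)[OF assms(1)] weak_partialD(1,2)[OF assms(2)]
  have "AE x in lebesgue. f x - g x = 0"
  proof (rule fundamental_lemma_variations)
    show "L1loc (\<lambda>x. f x - g x)" by (intro L1loc_diff L)
    fix \<phi> :: "'a \<Rightarrow> real" assume \<phi>: "test_fun \<phi>"
    have "(\<integral>x. v x * partial \<phi> i x \<partial>lebesgue) = (\<integral>x. w x * partial \<phi> i x \<partial>lebesgue)"
      using vw integrable_mult_partial[OF L(1) \<phi> i] integrable_mult_partial[OF L(3) \<phi> i]
      by (intro integral_cong_AE) (auto elim!: eventually_mono)
    then show "(\<integral>x. (f x - g x) * \<phi> x \<partial>lebesgue) = 0"
      using weak_partialD(3)[OF assms(1) \<phi>] weak_partialD(3)[OF assms(2) \<phi>]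
        integrable_mult_test_fun[OF L(2) \<phi>] integrable_mult_test_fun[OF L(4) \<phi>]
      by (simp add: left_diff_distrib)
  qed
  then show ?thesis by simp
qed

lemma sets_lebesgue_Collect:
  assumes "w \<in> borel_measurable lebesgue" "B \<in> sets borel"
  shows "{x. w x \<in> B} \<in> sets lebesgue"
  using measurable_sets[OF assms] by (simp add: vimage_def)

lemma weak_partial_shift:
  assumes "weak_partial i w g" "i \<in> Basis"
  shows "weak_partial i (\<lambda>x. w x - c) g"
  using weak_partial_diff[OF assms(1) weak_partial_const[OF assms(2), of c] assms(2)] by simp

text \<open>Both \<open>{w \<ge> c}\<close> and \<open>{w > c}\<close> are admissible for the
  positive part of \<open>w - c\<close>. Uniqueness equates the resulting derivatives, and the two
  sets differ exactly by the level set.\<close>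

lemma weak_partial_level_set:
  assumes w: "weak_partial i w g" and i: "i \<in> Basis"
  shows "AE x in lebesgue. w x = c \<longrightarrow> g x = 0"
proof -
  note m = L1loc_measurable[OF weak_partialD(1)[OF w]]
  have "weak_partial i (\<lambda>x. max (w x - c) 0) (\<lambda>x. indicator {x. w x \<in> {c..}} x * g x)"
    by (rule weak_partial_positive_part[OF weak_partial_shift[OF w i] i sets_lebesgue_Collect[OF m]]) auto
  moreover have "weak_partial i (\<lambda>x. max (w x - c) 0) (\<lambda>x. indicator {x. w x \<in> {c<..}} x * g x)"
    by (rule weak_partial_positive_part[OF weak_partial_shift[OF w i] i sets_lebesgue_Collect[OF m]]) auto
  ultimately have "AE x in lebesgue. indicator {x. w x \<in> {c..}} x * g x = indicator {x. w x \<in> {c<..}} x * g x"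
    by (rule weak_partial_unique[OF _ _ _ i]) simp
  then show ?thesis by eventually_elim auto
qed

text \<open>Truncation is a combination of positive parts, \<open>(w + t)^+ - (w - t)^+ - t\<close>.
  Taking the set open at \<open>- t\<close> and closed at \<open>t\<close> makes the difference of
  the indicators exactly that of \<open>{\<bar>w\<bar> < t}\<close>.\<close>

lemma weak_partial_truncation:
  assumes w: "weak_partial i w g" and i: "i \<in> Basis" and t: "t > 0"
  shows "weak_partial i (\<lambda>x. T t (w x)) (\<lambda>x. indicator {x. \<bar>w x\<bar> < t} x * g x)"
proof -
  note m = L1loc_measurable[OF weak_partialD(1)[OF w]]
  have "weak_partial i (\<lambda>x. max (w x - (- t)) 0) (\<lambda>x. indicator {x. w x \<in> {- t<..}} x * g x)"
    by (rule weak_partial_positive_part[OF weak_partial_shift[OF w i] i sets_lebesgue_Collect[OF m]]) auto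
  moreover have "weak_partial i (\<lambda>x. max (w x - t) 0) (\<lambda>x. indicator {x. w x \<in> {t..}} x * g x)"
    by (rule weak_partial_positive_part[OF weak_partial_shift[OF w i] i sets_lebesgue_Collect[OF m]]) auto
  ultimately have "weak_partial i (\<lambda>x. max (w x - (- t)) 0 - max (w x - t) 0 - t)
      (\<lambda>x. indicator {x. w x \<in> {- t<..}} x * g x - indicator {x. w x \<in> {t..}} x * g x)"
    using i by (intro weak_partial_shift weak_partial_diff)
  moreover have "(\<lambda>x. max (w x - (- t)) 0 - max (w x - t) 0 - t) = (\<lambda>x. T t (w x))"
    using t by (auto simp: T_def)
  moreover have "(\<lambda>x. indicator {x. w x \<in> {- t<..}} x * g x - indicator {x. w x \<in> {t..}} x * g x)
      = (\<lambda>x. indicator {x. \<bar>w x\<bar> < t} x * g x)"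
    using t by (auto simp: indicator_def fun_eq_iff)
  ultimately show ?thesis by simp
qed

subsection \<open>Weak gradients and auxiliary limits\<close>

lemma is_weak_grad_truncation:
  assumes "is_weak_grad w G" "t > 0"
  shows "is_weak_grad (\<lambda>x. T t (w x)) (\<lambda>x. indicator {x. \<bar>w x\<bar> < t} x *\<^sub>R G x)"
  using assms by (auto simp: is_weak_grad_iff intro!: weak_partial_truncation)

lemma is_weak_grad_diff:
  assumes "is_weak_grad v F" "is_weak_grad w G"
  shows "is_weak_grad (\<lambda>x. v x - w x) (\<lambda>x. F x - G x)"
  using assms by (auto simp: is_weak_grad_iff inner_diff_left intro!: weak_partial_diff)

lemma is_weak_grad_unique:
  fixes F G :: "'a::euclidean_space \<Rightarrow> 'a"
  assumes "is_weak_grad v F" "is_weak_grad w G" "AE x in lebesgue. v x = w x"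
  shows "AE x in lebesgue. F x = G x"
proof -
  have "AE x in lebesgue. \<forall>i\<in>Basis. F x \<bullet> i = G x \<bullet> i"
    using assms(1,2) by (intro AE_finite_allI weak_partial_unique[OF _ _ assms(3)]) (auto simp: is_weak_grad_iff)
  then show ?thesis by eventually_elim (auto intro: euclidean_eqI)
qed

lemma is_weak_grad_level_set:
  fixes G :: "'a::euclidean_space \<Rightarrow> 'a"
  assumes "is_weak_grad w G"
  shows "AE x in lebesgue. w x = c \<longrightarrow> G x = 0"
proof -
  have "AE x in lebesgue. \<forall>i\<in>Basis. w x = c \<longrightarrow> G x \<bullet> i = 0"
    using assms by (intro AE_finite_allI weak_partial_level_set) (auto simp: is_weak_grad_iff)
  then show ?thesis by eventually_elim (auto simp: euclidean_all_zero_iff)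
qed

lemma is_weak_grad_wgrad: "is_weak_grad w G \<Longrightarrow> is_weak_grad w (wgrad w)"
  unfolding wgrad_def by (rule someI[of "is_weak_grad w"])

lemma wgrad_eq_AE: "is_weak_grad w G \<Longrightarrow> AE x in lebesgue. wgrad w x = G x"
  by (rule is_weak_grad_unique[OF is_weak_grad_wgrad]) auto

lemma is_weak_grad_measurable: "is_weak_grad w G \<Longrightarrow> G \<in> borel_measurable lebesgue"
  by (subst borel_measurable_euclidean_space) (auto simp: is_weak_grad_def L1loc_def)

lemma powr_add_le:
  fixes a b p :: real
  assumes "a \<ge> 0" "b \<ge> 0" "p \<ge> 0"
  shows "(a + b) powr p \<le> 2 powr p * (a powr p + b powr p)"
proof -
  have "(a + b) powr p \<le> (2 * max a b) powr p"
    using assms by (intro powr_mono2) auto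
  also have "\<dots> = 2 powr p * max a b powr p"
    using assms by (simp add: powr_mult)
  also have "\<dots> \<le> 2 powr p * (a powr p + b powr p)"
    by (intro mult_left_mono) (auto simp: max_def)
  finally show ?thesis .
qed

lemma integrable_powr_add:
  fixes f g :: "'a \<Rightarrow> real"
  assumes "f \<in> borel_measurable M" "g \<in> borel_measurable M" "\<And>x. f x \<ge> 0" "\<And>x. g x \<ge> 0" "p \<ge> 0"
    "integrable M (\<lambda>x. f x powr p)" "integrable M (\<lambda>x. g x powr p)"
  shows "integrable M (\<lambda>x. (f x + g x) powr p)"
proof (rule Bochner_Integration.integrable_bound)
  show "integrable M (\<lambda>x. 2 powr p * (f x powr p + g x powr p))"
    using assms by auto
  show "AE x in M. norm ((f x + g x) powr p) \<le> norm (2 powr p * (f x powr p + g x powr p))"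
    using powr_add_le[of "f _" "g _" p] assms by (intro AE_I2) (auto simp: abs_mult)
qed (use assms in auto)

lemma integrable_powr_bound:
  fixes f g :: "'a \<Rightarrow> real"
  assumes "integrable M (\<lambda>x. g x powr p)" "f \<in> borel_measurable M" "\<And>x. 0 \<le> f x" "\<And>x. f x \<le> g x" "p \<ge> 0"
  shows "integrable M (\<lambda>x. f x powr p)"
  by (rule Bochner_Integration.integrable_bound[OF assms(1)])
    (use assms in \<open>auto intro!: powr_mono2\<close>)

text \<open>The gradient witnessing membership in the Sobolev space need not be the chosen
  \<open>wgrad\<close>; uniqueness almost everywhere transfers the integrability.\<close>

lemma W1p_wgrad:
  assumes "W1p p w"
  shows "is_weak_grad w (wgrad w)" "integrable lebesgue (\<lambda>x. norm (wgrad w x) powr p)"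
    "w \<in> borel_measurable lebesgue" "wgrad w \<in> borel_measurable lebesgue"
proof -
  obtain G where G: "is_weak_grad w G" "Lp p (\<lambda>x. norm (G x))"
    using assms by (auto simp: W1p_def)
  show wg: "is_weak_grad w (wgrad w)" using is_weak_grad_wgrad[OF G(1)] .
  show "w \<in> borel_measurable lebesgue" using assms by (auto simp: W1p_def Lp_def)
  show m: "wgrad w \<in> borel_measurable lebesgue" by (rule is_weak_grad_measurable[OF wg])
  note [measurable] = m is_weak_grad_measurable[OF G(1)]
  have int: "integrable lebesgue (\<lambda>x. norm (G x) powr p)"
    using G(2) by (simp add: Lp_def)
  have ae: "AE x in lebesgue. norm (G x) powr p = norm (wgrad w x) powr p"
    using wgrad_eq_AE[OF G(1)] by eventually_elim simp
  show "integrable lebesgue (\<lambda>x. norm (wgrad w x) powr p)"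
    by (rule integrable_cong_AE_imp[OF int _ ae]) measurable
qed

text \<open>Choosing norms below \<open>(1/2)^n\<close> makes the sum of all
  \<open>\<bar>F (r j)\<bar>\<close> integrable. Being finite almost everywhere it forces its terms
  to 0, and it is at the same time a majorant of each of them.\<close>

lemma L1_rapid_subsequence:
  fixes F :: "nat \<Rightarrow> 'a \<Rightarrow> real"
  assumes int: "\<And>j. integrable M (F j)" and lim: "(\<lambda>j. \<integral>x. \<bar>F j x\<bar> \<partial>M) \<longlonglongrightarrow> 0"
  obtains r H where "strict_mono (r :: nat \<Rightarrow> nat)" "integrable M H"
    "AE x in M. (\<lambda>j. F (r j) x) \<longlonglongrightarrow> 0" "AE x in M. \<forall>j. \<bar>F (r j) x\<bar> \<le> H x"
proof -
  have "\<exists>r. \<forall>n. (\<integral>x. \<bar>F (r n) x\<bar> \<partial>M) \<le> (1/2)^n \<and> r n < (r (Suc n) :: nat)"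
  proof (rule dependent_nat_choice)
    have ex: "\<exists>N. \<forall>m\<ge>N. (\<integral>x. \<bar>F m x\<bar> \<partial>M) \<le> (1/2)^n" for n :: nat
      using order_tendstoD(2)[OF lim, of "(1/2)^n"] unfolding eventually_sequentially
      by (meson less_imp_le zero_less_divide_1_iff zero_less_numeral zero_less_power)
    show "\<exists>x. (\<integral>y. \<bar>F x y\<bar> \<partial>M) \<le> (1/2)^0" using ex[of 0] by auto
    show "\<exists>y. (\<integral>x. \<bar>F y x\<bar> \<partial>M) \<le> (1/2)^Suc n \<and> x < y" for x n
    proof -
      obtain N where "\<forall>m\<ge>N. (\<integral>x. \<bar>F m x\<bar> \<partial>M) \<le> (1/2)^Suc n" using ex by blast
      then show ?thesis by (intro exI[of _ "max N (Suc x)"]) auto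
    qed
  qed
  then obtain r :: "nat \<Rightarrow> nat" where r: "\<And>n. (\<integral>x. \<bar>F (r n) x\<bar> \<partial>M) \<le> (1/2)^n" "\<And>n. r n < r (Suc n)"
    by blast
  note [measurable] = borel_measurable_integrable[OF int]
  define h where "h x = (\<Sum>j. ennreal \<bar>F (r j) x\<bar>)" for x
  have hm [measurable]: "h \<in> borel_measurable M" unfolding h_def by measurable
  have "(\<integral>\<^sup>+x. h x \<partial>M) = (\<Sum>j. \<integral>\<^sup>+x. ennreal \<bar>F (r j) x\<bar> \<partial>M)"
    unfolding h_def by (intro nn_integral_suminf) measurable
  also have "\<dots> = (\<Sum>j. ennreal (\<integral>x. \<bar>F (r j) x\<bar> \<partial>M))"
    using int by (intro suminf_cong nn_integral_eq_integral) auto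
  also have "\<dots> \<le> (\<Sum>j. ennreal ((1/2)^j))"
    using r(1) by (intro suminf_le ennreal_leI) auto
  also have "\<dots> = ennreal (\<Sum>j. (1/2)^j)"
    by (intro suminf_ennreal2 summable_geometric) auto
  finally have hfin: "(\<integral>\<^sup>+x. h x \<partial>M) < \<infinity>"
    by (metis ennreal_less_top infinity_ennreal_def order_le_less_trans)
  then have ae: "AE x in M. h x \<noteq> \<infinity>"
    by (intro nn_integral_PInf_AE) auto
  show ?thesis
  \<comment> \<open>\<open>enn2real\<close> sends infinite values to 0, which concerns only a null
    set.\<close>
  proof (rule that[of r "\<lambda>x. enn2real (h x)"])
    show "strict_mono r" using r(2) by (simp add: strict_mono_Suc_iff)
    show "integrable M (\<lambda>x. enn2real (h x))"
    proof (rule integrableI_bounded)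
      have "(\<integral>\<^sup>+x. ennreal (norm (enn2real (h x))) \<partial>M) \<le> (\<integral>\<^sup>+x. h x \<partial>M)"
        by (intro nn_integral_mono) (simp add: ennreal_enn2real_if)
      then show "(\<integral>\<^sup>+x. ennreal (norm (enn2real (h x))) \<partial>M) < \<infinity>"
        using hfin by order
    qed measurable
    have sm: "AE x in M. summable (\<lambda>j. \<bar>F (r j) x\<bar>) \<and> enn2real (h x) = (\<Sum>j. \<bar>F (r j) x\<bar>)"
      using ae
    proof eventually_elim
      case (elim x)
      then have s: "summable (\<lambda>j. \<bar>F (r j) x\<bar>)"
        unfolding h_def by (intro summable_suminf_not_top) auto
      then have "h x = ennreal (\<Sum>j. \<bar>F (r j) x\<bar>)"
        unfolding h_def by (intro suminf_ennreal2) auto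
      then show ?case using s by (simp add: suminf_nonneg)
    qed
    then show "AE x in M. (\<lambda>j. F (r j) x) \<longlonglongrightarrow> 0"
      by eventually_elim (auto dest!: summable_LIMSEQ_zero simp: tendsto_rabs_zero_iff)
    show "AE x in M. \<forall>j. \<bar>F (r j) x\<bar> \<le> enn2real (h x)"
      using sm
    proof eventually_elim
      case (elim x)
      then show ?case
        using sum_le_suminf[of "\<lambda>j. \<bar>F (r j) x\<bar>" "{_}"] by auto
    qed
  qed
qed

text \<open>A single p-th power is a crude bound, but it reduces domination to p-integrability of
  the two fields. Real numbers form an inner product space, so the potential term is covered as
  well.\<close>

lemma p_flux_bound:
  fixes \<xi> \<eta> :: "'a::real_inner"
  assumes "p \<ge> 2"
  shows "\<bar>norm \<xi> powr (p - 2) * (\<xi> \<bullet> \<eta>)\<bar> \<le> (norm \<xi> + norm \<eta>) powr p"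
proof (cases "\<xi> = 0")
  case False
  let ?s = "norm \<xi> + norm \<eta>"
  have s: "?s > 0" using False by (simp add: add_pos_nonneg)
  have "\<bar>norm \<xi> powr (p - 2) * (\<xi> \<bullet> \<eta>)\<bar> = norm \<xi> powr (p - 2) * \<bar>\<xi> \<bullet> \<eta>\<bar>"
    by (simp add: abs_mult)
  also have "\<dots> \<le> ?s powr (p - 2) * (?s * ?s)"
  proof (rule mult_mono)
    show "norm \<xi> powr (p - 2) \<le> ?s powr (p - 2)" using assms by (intro powr_mono2) auto
    show "\<bar>\<xi> \<bullet> \<eta>\<bar> \<le> ?s * ?s"
      by (rule order_trans[OF Cauchy_Schwarz_ineq2]) (intro mult_mono; simp)
  qed auto
  also have "\<dots> = ?s powr (p - 2) * ?s powr 2"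
    using s by (simp add: power2_eq_square)
  also have "\<dots> = ?s powr p"
    using powr_add[of ?s "p - 2" 2] by simp
  finally show ?thesis .
qed simp

text \<open>The power alone can be discontinuous at a zero limit when \<open>p = 2\<close>, because
  \<open>0 powr 0 = 0\<close>. There the factor is at most 1 as soon as
  \<open>norm (\<xi> j) < 1\<close>, and the inner product tends to 0 by itself.\<close>

lemma p_flux_tendsto:
  fixes \<xi> \<eta> :: "nat \<Rightarrow> 'a::real_inner"
  assumes p: "p \<ge> 2" and X: "\<xi> \<longlonglongrightarrow> x" and Y: "\<eta> \<longlonglongrightarrow> y"
  shows "(\<lambda>j. norm (\<xi> j) powr (p - 2) * (\<xi> j \<bullet> \<eta> j)) \<longlonglongrightarrow> norm x powr (p - 2) * (x \<bullet> y)"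
proof (cases "x = 0")
  case False
  then show ?thesis
    by (intro tendsto_mult tendsto_powr tendsto_norm tendsto_inner tendsto_const X Y) auto
next
  case True
  have "(\<lambda>j. norm (\<xi> j) powr (p - 2) * (\<xi> j \<bullet> \<eta> j)) \<longlonglongrightarrow> 0"
  proof (rule Lim_null_comparison)
    have "\<forall>\<^sub>F j in sequentially. norm (\<xi> j) < 1"
      using order_tendstoD(2)[OF tendsto_norm[OF X], of 1] True by simp
    then show "\<forall>\<^sub>F j in sequentially. norm (norm (\<xi> j) powr (p - 2) * (\<xi> j \<bullet> \<eta> j)) \<le> norm (\<xi> j) * norm (\<eta> j)"
    proof eventually_elim
      case (elim j)
      have "norm (\<xi> j) powr (p - 2) \<le> 1"
        using elim p by (intro powr_le1) auto
      from mult_mono[OF this Cauchy_Schwarz_ineq2[of "\<xi> j" "\<eta> j"]]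
      show ?case by (simp add: abs_mult)
    qed
    have "(\<lambda>j. norm (\<xi> j) * norm (\<eta> j)) \<longlonglongrightarrow> norm x * norm y"
      by (intro tendsto_intros X Y)
    then show "(\<lambda>j. norm (\<xi> j) * norm (\<eta> j)) \<longlonglongrightarrow> 0" using True by simp
  qed
  then show ?thesis using True by simp
qed

lemma cutoff_tendsto:
  fixes y :: "nat \<Rightarrow> 'a::real_normed_vector"
  assumes a: "a \<longlonglongrightarrow> (b::real)" and y: "y \<longlonglongrightarrow> z" and "\<bar>b\<bar> = t \<Longrightarrow> z = 0"
  shows "(\<lambda>j. (if \<bar>a j\<bar> < t then y j else 0)) \<longlonglongrightarrow> (if \<bar>b\<bar> < t then z else 0)"
proof -
  note ab = tendsto_rabs[OF a]
  consider "\<bar>b\<bar> < t" | "\<bar>b\<bar> > t" | "\<bar>b\<bar> = t" by linarith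
  then show ?thesis
  proof cases
    case 1
    then have "\<forall>\<^sub>F j in sequentially. y j = (if \<bar>a j\<bar> < t then y j else 0)"
      using order_tendstoD(2)[OF ab 1] by (auto elim!: eventually_mono)
    then show ?thesis using y 1 by (simp cong: tendsto_cong)
  next
    case 2
    then have "\<forall>\<^sub>F j in sequentially. (if \<bar>a j\<bar> < t then y j else 0) = 0"
      using order_tendstoD(1)[OF ab 2] by (auto elim!: eventually_mono)
    then show ?thesis using 2 by (simp add: tendsto_eventually)
  next
    case 3
    then have "y \<longlonglongrightarrow> 0" using y assms(3) by simp
    then have "(\<lambda>j. (if \<bar>a j\<bar> < t then y j else 0)) \<longlonglongrightarrow> 0"
      by (rule Lim_null_comparison[rotated, OF tendsto_norm_zero]) auto
    then show ?thesis using 3 by simp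
  qed
qed

lemma T_bound: "t > 0 \<Longrightarrow> \<bar>T t s\<bar> \<le> t"
  by (auto simp: T_def)

lemma T_abs_le: "t > 0 \<Longrightarrow> \<bar>T t s\<bar> \<le> \<bar>s\<bar>"
  by (auto simp: T_def)

lemma T_lipschitz: "\<bar>T t a - T t b\<bar> \<le> \<bar>a - b\<bar>"
  by (auto simp: T_def)

lemma T_tendsto: "(a \<longlongrightarrow> b) F \<Longrightarrow> ((\<lambda>j. T t (a j)) \<longlongrightarrow> T t b) F"
  unfolding T_def by (intro tendsto_intros)

lemma T_measurable: "w \<in> borel_measurable M \<Longrightarrow> (\<lambda>x. T t (w x)) \<in> borel_measurable M"
  unfolding T_def by (intro borel_measurable_max borel_measurable_min borel_measurable_const)

subsection \<open>The test function of the localized formulation\<close>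

text \<open>A pointwise representative of the gradient of \<open>HH\<close>, with the gradients of
  the truncation and of \<open>\<phi>\<close> as parameters. Unlike the chosen
  \<open>wgrad (HH ...)\<close>, it can be followed to the limit at a fixed point.\<close>

definition HH_grad :: "real \<Rightarrow> real \<Rightarrow> ('a \<Rightarrow> real) \<Rightarrow> ('a \<Rightarrow> 'a) \<Rightarrow> ('a \<Rightarrow> real) \<Rightarrow> ('a \<Rightarrow> 'a) \<Rightarrow> 'a \<Rightarrow> 'a::euclidean_space"
  where "HH_grad \<alpha> t v G \<phi> \<Phi> x =
    (if \<bar>T \<alpha> (v x) - \<phi> x\<bar> < t then G x - \<Phi> x else 0) - (if \<bar>T \<alpha> (v x)\<bar> < t then G x else 0)"

lemma is_weak_grad_HH:
  assumes "is_weak_grad (\<lambda>x. T \<alpha> (v x)) G" "is_weak_grad \<phi> \<Phi>" "t > 0"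
  shows "is_weak_grad (HH \<alpha> t v \<phi>) (HH_grad \<alpha> t v G \<phi> \<Phi>)"
proof -
  have eq: "HH_grad \<alpha> t v G \<phi> \<Phi> = (\<lambda>x. indicator {x. \<bar>T \<alpha> (v x) - \<phi> x\<bar> < t} x *\<^sub>R (G x - \<Phi> x)
      - indicator {x. \<bar>T \<alpha> (v x)\<bar> < t} x *\<^sub>R G x)"
    by (auto simp: HH_grad_def fun_eq_iff)
  show ?thesis
    unfolding HH_def eq
    by (intro is_weak_grad_diff is_weak_grad_truncation assms)
qed

text \<open>\<open>T t\<close> is 1-Lipschitz and its two arguments differ by
  \<open>\<phi> x\<close>. Boundedness and compact support of \<open>HH\<close> are both read off
  from this.\<close>

lemma HH_abs_le: "\<bar>HH \<alpha> t v \<phi> x\<bar> \<le> \<bar>\<phi> x\<bar>"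
  using T_lipschitz[of t "T \<alpha> (v x) - \<phi> x" "T \<alpha> (v x)"] by (simp add: HH_def)

text \<open>If \<open>\<bar>v x\<bar> \<ge> \<alpha>\<close>, then \<open>T \<alpha> (v x)\<close>
  is \<open>\<alpha>\<close> or \<open>- \<alpha>\<close>, and subtracting \<open>\<phi> x\<close>
  keeps its sign and a modulus above \<open>t\<close>. Both truncations at level \<open>t\<close>
  are saturated at the same value.\<close>

lemma HH_eq_0:
  assumes "t > 0" "\<bar>\<phi> x\<bar> < \<alpha> - t" "\<alpha> \<le> \<bar>v x\<bar>"
  shows "HH \<alpha> t v \<phi> x = 0" "HH_grad \<alpha> t v G \<phi> \<Phi> x = 0"
  using assms unfolding HH_def HH_grad_def T_def by (auto simp: max_def min_def)

lemma HH_grad_outside: "\<phi> x = 0 \<Longrightarrow> \<Phi> x = 0 \<Longrightarrow> HH_grad \<alpha> t v G \<phi> \<Phi> x = 0"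
  by (simp add: HH_grad_def)

lemma norm_HH_grad_le: "norm (HH_grad \<alpha> t v G \<phi> \<Phi> x) \<le> 2 * norm (G x) + norm (\<Phi> x)"
  using norm_triangle_ineq4[of "G x" "\<Phi> x"] norm_triangle_ineq4[of "G x - \<Phi> x" "G x"]
  by (auto simp: HH_grad_def)

lemma HH_measurable:
  assumes "v \<in> borel_measurable M" "\<phi> \<in> borel_measurable M"
  shows "HH \<alpha> t v \<phi> \<in> borel_measurable M"
  unfolding HH_def by (intro borel_measurable_diff T_measurable assms)

lemma W1p_truncation:
  assumes w: "W1p p w" and t: "t > 0" and p: "p > 0"
  shows "W1p p (\<lambda>x. T t (w x))"
  unfolding W1p_def
proof (intro conjI exI)
  note W = W1p_wgrad[OF w]
  have Lp: "integrable lebesgue (\<lambda>x. \<bar>w x\<bar> powr p)" using w by (simp add: W1p_def Lp_def)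
  have m: "(\<lambda>x. T t (w x)) \<in> borel_measurable lebesgue" by (intro T_measurable W)
  show "Lp p (\<lambda>x. T t (w x))"
    unfolding Lp_def using m p T_abs_le[OF t]
    by (auto intro!: integrable_powr_bound[OF Lp] borel_measurable_abs)
  show g: "is_weak_grad (\<lambda>x. T t (w x)) (\<lambda>x. indicator {x. \<bar>w x\<bar> < t} x *\<^sub>R wgrad w x)"
    by (intro is_weak_grad_truncation W t)
  show "Lp p (\<lambda>x. norm (indicator {x. \<bar>w x\<bar> < t} x *\<^sub>R wgrad w x))"
    unfolding Lp_def using is_weak_grad_measurable[OF g] p
    by (auto intro!: integrable_powr_bound[OF W(2)] borel_measurable_norm simp del: norm_scaleR)
      (auto simp: indicator_def)
qed

text \<open>On \<open>K\<close> the potential is bounded, and off \<open>K\<close> the function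
  vanishes with \<open>\<phi>\<close>. The weighted integral is thus controlled by the unweighted
  one.\<close>

lemma inX_HH:
  fixes V \<phi> v :: "'a::euclidean_space \<Rightarrow> real"
  assumes p: "p > 0" and V: "Linf_loc V" and v: "W1p p (\<lambda>x. T \<alpha> (v x))" and \<phi>: "W1p p \<phi>"
    and K: "compact K" "AE x in lebesgue. x \<notin> K \<longrightarrow> \<phi> x = 0" and t: "t > 0"
  shows "inX V p (HH \<alpha> t v \<phi>)"
proof -
  note W = W1p_wgrad[OF v] and F = W1p_wgrad[OF \<phi>]
  have g: "is_weak_grad (HH \<alpha> t v \<phi>) (HH_grad \<alpha> t v (wgrad (\<lambda>x. T \<alpha> (v x))) \<phi> (wgrad \<phi>))"
    by (intro is_weak_grad_HH W F t)
  have m: "HH \<alpha> t v \<phi> \<in> borel_measurable lebesgue"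
    using g by (auto simp: is_weak_grad_def L1loc_def)
  have Lp: "integrable lebesgue (\<lambda>x. \<bar>\<phi> x\<bar> powr p)" using \<phi> by (simp add: W1p_def Lp_def)
  have LpH: "integrable lebesgue (\<lambda>x. \<bar>HH \<alpha> t v \<phi> x\<bar> powr p)"
    using m p HH_abs_le by (auto intro!: integrable_powr_bound[OF Lp] borel_measurable_abs)
  let ?G = "\<lambda>x. norm (wgrad (\<lambda>x. T \<alpha> (v x)) x)" and ?P = "\<lambda>x. norm (wgrad \<phi> x)"
  have i1: "integrable lebesgue (\<lambda>x. (2 * ?G x) powr p)"
    using W(2) by (simp add: powr_mult)
  have i2: "integrable lebesgue (\<lambda>x. (2 * ?G x + ?P x) powr p)"
    using W(4) F(4) p by (intro integrable_powr_add i1 F(2)) auto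
  have "Lp p (\<lambda>x. norm (HH_grad \<alpha> t v (wgrad (\<lambda>x. T \<alpha> (v x))) \<phi> (wgrad \<phi>) x))"
    unfolding Lp_def using is_weak_grad_measurable[OF g] p norm_HH_grad_le
    by (auto intro!: integrable_powr_bound[OF i2] borel_measurable_norm)
  then have "W1p p (HH \<alpha> t v \<phi>)"
    unfolding W1p_def Lp_def[of p "HH \<alpha> t v \<phi>"] using m LpH g by blast
  moreover have "integrable lebesgue (\<lambda>x. V x * \<bar>HH \<alpha> t v \<phi> x\<bar> powr p)"
  proof -
    obtain C where C: "AE x in lebesgue. x \<in> K \<longrightarrow> \<bar>V x\<bar> \<le> C"
      using V K(1) by (auto simp: Linf_loc_def)
    have [measurable]: "V \<in> borel_measurable lebesgue" using V by (simp add: Linf_loc_def)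
    note [measurable] = m
    show ?thesis
    proof (rule Bochner_Integration.integrable_bound)
      show "integrable lebesgue (\<lambda>x. \<bar>C\<bar> * \<bar>HH \<alpha> t v \<phi> x\<bar> powr p)" using LpH by simp
      show "AE x in lebesgue. norm (V x * \<bar>HH \<alpha> t v \<phi> x\<bar> powr p) \<le> norm (\<bar>C\<bar> * \<bar>HH \<alpha> t v \<phi> x\<bar> powr p)"
        using C K(2)
      proof eventually_elim
        case (elim x)
        show ?case
        proof (cases "x \<in> K")
          case True
          then have "\<bar>V x\<bar> \<le> \<bar>C\<bar>" using elim by linarith
          then show ?thesis by (simp add: abs_mult mult_right_mono)
        next
          case False
          then have "HH \<alpha> t v \<phi> x = 0" using elim HH_abs_le[of \<alpha> t v \<phi> x] by simp
          then show ?thesis by simp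
        qed
      qed
    qed measurable
  qed
  ultimately show ?thesis by (simp add: inX_def)
qed

text \<open>The equation is rewritten so that \<open>w\<close> enters only through its truncation
  and every gradient of \<open>HH\<close> is explicit. The potential term is arranged as a
  one-dimensional flux times \<open>V\<close>, so that the same flux estimates serve both
  terms.\<close>

lemma weak_energy_sol_truncated:
  fixes V \<phi> w g :: "'a::euclidean_space \<Rightarrow> real"
  assumes p: "p > 0" and V: "Linf_loc V" and sol: "weak_energy_sol V p g w" and \<phi>: "W1p p \<phi>"
    and K: "compact K" "AE x in lebesgue. x \<notin> K \<longrightarrow> \<phi> x = 0" and t: "t > 0"
    and small: "AE x in lebesgue. \<bar>\<phi> x\<bar> < \<alpha> - t" and \<alpha>: "\<alpha> > 0"
  defines "G \<equiv> wgrad (\<lambda>x. T \<alpha> (w x))"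
  shows "(\<integral>x. norm (G x) powr (p - 2) * (G x \<bullet> HH_grad \<alpha> t w G \<phi> (wgrad \<phi>) x) \<partial>lebesgue)
    + (\<integral>x. \<bar>T \<alpha> (w x)\<bar> powr (p - 2) * (T \<alpha> (w x) * HH \<alpha> t w \<phi> x) * V x \<partial>lebesgue)
    = (\<integral>x. g x * HH \<alpha> t w \<phi> x \<partial>lebesgue)"
proof -
  have w: "W1p p w" using sol by (simp add: weak_energy_sol_def inX_def)
  have Tw: "W1p p (\<lambda>x. T \<alpha> (w x))" by (rule W1p_truncation[OF w \<alpha> p])
  note W = W1p_wgrad[OF w] and TW = W1p_wgrad[OF Tw, folded G_def] and F = W1p_wgrad[OF \<phi>]
  have g: "is_weak_grad (HH \<alpha> t w \<phi>) (HH_grad \<alpha> t w G \<phi> (wgrad \<phi>))"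
    by (intro is_weak_grad_HH TW F t)
  have [measurable]: "V \<in> borel_measurable lebesgue" using V by (simp add: Linf_loc_def)
  note [measurable] = HH_measurable[OF W(3) F(3)] W(3,4) TW(3,4) is_weak_grad_measurable[OF g]
    is_weak_grad_measurable[OF is_weak_grad_wgrad[OF g]]
  \<comment> \<open>Where \<open>\<bar>w x\<bar> < \<alpha>\<close>, the truncation formula
    identifies \<open>G\<close> with \<open>wgrad w\<close>; elsewhere the gradient of the test
    function is zero on both sides.\<close>
  have 1: "(\<integral>x. norm (wgrad w x) powr (p - 2) * (wgrad w x \<bullet> wgrad (HH \<alpha> t w \<phi>) x) \<partial>lebesgue)
      = (\<integral>x. norm (G x) powr (p - 2) * (G x \<bullet> HH_grad \<alpha> t w G \<phi> (wgrad \<phi>) x) \<partial>lebesgue)"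
  proof (rule integral_cong_AE)
    show "AE x in lebesgue. norm (wgrad w x) powr (p - 2) * (wgrad w x \<bullet> wgrad (HH \<alpha> t w \<phi>) x)
        = norm (G x) powr (p - 2) * (G x \<bullet> HH_grad \<alpha> t w G \<phi> (wgrad \<phi>) x)"
      using wgrad_eq_AE[OF g] wgrad_eq_AE[OF is_weak_grad_truncation[OF W(1) \<alpha>]] small
    proof eventually_elim
      case (elim x)
      show ?case
      proof (cases "\<bar>w x\<bar> < \<alpha>")
        case True
        then show ?thesis using elim by (simp add: G_def)
      next
        case False
        then show ?thesis using elim HH_eq_0(2)[of t \<phi> x \<alpha> w] t by simp
      qed
    qed
  qed measurable
  have 2: "(\<integral>x. V x * \<bar>w x\<bar> powr (p - 2) * w x * HH \<alpha> t w \<phi> x \<partial>lebesgue)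
      = (\<integral>x. \<bar>T \<alpha> (w x)\<bar> powr (p - 2) * (T \<alpha> (w x) * HH \<alpha> t w \<phi> x) * V x \<partial>lebesgue)"
  proof (rule integral_cong_AE)
    show "AE x in lebesgue. V x * \<bar>w x\<bar> powr (p - 2) * w x * HH \<alpha> t w \<phi> x
        = \<bar>T \<alpha> (w x)\<bar> powr (p - 2) * (T \<alpha> (w x) * HH \<alpha> t w \<phi> x) * V x"
      using small
    proof eventually_elim
      case (elim x)
      show ?case
      proof (cases "\<bar>w x\<bar> < \<alpha>")
        case True
        then have "T \<alpha> (w x) = w x" by (auto simp: T_def)
        then show ?thesis by simp
      next
        case False
        then show ?thesis using elim HH_eq_0(1)[of t \<phi> x \<alpha> w] t by simp
      qed
    qed
  qed measurable
  have "inX V p (HH \<alpha> t w \<phi>)"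
    by (rule inX_HH[OF p V Tw \<phi> K t])
  with sol have "(\<integral>x. norm (wgrad w x) powr (p - 2) * (wgrad w x \<bullet> wgrad (HH \<alpha> t w \<phi>) x) \<partial>lebesgue)
      + (\<integral>x. V x * \<bar>w x\<bar> powr (p - 2) * w x * HH \<alpha> t w \<phi> x \<partial>lebesgue)
      = (\<integral>x. g x * HH \<alpha> t w \<phi> x \<partial>lebesgue)"
    unfolding weak_energy_sol_def by blast
  then show ?thesis
    unfolding 1 2 .
qed

text \<open>The parameter \<open>d\<close> is a further error to be controlled along the same
  subsequence. It is summed with \<open>V * \<bar>T 1 (us j - u)\<bar> powr p\<close>; both are
  nonnegative almost everywhere, so convergence and majorant of the sum pass to each
  summand.\<close>

lemma approx_seq_subsequence:
  fixes V f u :: "'a::euclidean_space \<Rightarrow> real" and d :: "nat \<Rightarrow> 'a \<Rightarrow> real"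
  assumes p: "p > 0" and V1: "AE x in lebesgue. V x \<ge> 1" and ap: "approx_seq V p f u us fs"
    and d: "\<And>j. integrable lebesgue (d j)" "\<And>j x. d j x \<ge> 0" "(\<lambda>j. \<integral>x. d j x \<partial>lebesgue) \<longlonglongrightarrow> 0"
  obtains r H where "strict_mono (r :: nat \<Rightarrow> nat)" "integrable lebesgue H"
    "AE x in lebesgue. (\<lambda>j. us (r j) x) \<longlonglongrightarrow> u x"
    "AE x in lebesgue. (\<lambda>j. d (r j) x) \<longlonglongrightarrow> 0" "AE x in lebesgue. \<forall>j. d (r j) x \<le> H x"
proof -
  let ?e = "\<lambda>j x. V x * \<bar>T 1 (us j x - u x)\<bar> powr p"
  have inX: "inX V p (\<lambda>x. T 1 (us j x - u x))" for j
    using ap by (auto simp: approx_seq_def)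
  have e: "integrable lebesgue (?e j)" for j
    using inX[of j] by (simp add: inX_def)
  have enn: "AE x in lebesgue. 0 \<le> ?e j x" for j
    using V1 by eventually_elim simp
  let ?n = "\<lambda>j. normX V p (\<lambda>x. T 1 (us j x - u x))"
  have e0: "(\<lambda>j. \<integral>x. ?e j x \<partial>lebesgue) \<longlonglongrightarrow> 0"
  proof (rule tendsto_sandwich[of "\<lambda>_. 0" _ _ "\<lambda>j. ?n j powr p"])
    let ?g = "\<lambda>j. \<integral>x. norm (wgrad (\<lambda>x. T 1 (us j x - u x)) x) powr p \<partial>lebesgue"
    have ge: "?g j \<ge> 0" "(\<integral>x. ?e j x \<partial>lebesgue) \<ge> 0" for j
      using enn by (auto intro!: integral_nonneg_AE)
    \<comment> \<open>Both integrals are nonnegative, so the p-th power undoes the root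
      exactly.\<close>
    have "?n j powr p = ?g j + (\<integral>x. ?e j x \<partial>lebesgue)" for j
      using ge[of j] p by (simp add: normX_def powr_powr)
    then show "\<forall>\<^sub>F j in sequentially. (\<integral>x. ?e j x \<partial>lebesgue) \<le> ?n j powr p"
      using ge by simp
    have "?n \<longlonglongrightarrow> 0" using ap by (auto simp: approx_seq_def)
    then have "(\<lambda>j. ?n j powr p) \<longlonglongrightarrow> 0 powr p"
      using p by (intro tendsto_powr') (auto simp: normX_def)
    then show "(\<lambda>j. ?n j powr p) \<longlonglongrightarrow> 0" using p by simp
    show "\<forall>\<^sub>F j in sequentially. 0 \<le> (\<integral>x. ?e j x \<partial>lebesgue)" using ge by simp
  qed simp
  let ?F = "\<lambda>j x. d j x + ?e j x"
  have "(\<integral>x. \<bar>?F j x\<bar> \<partial>lebesgue) = (\<integral>x. d j x \<partial>lebesgue) + (\<integral>x. ?e j x \<partial>lebesgue)" for j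
  proof -
    have "(\<integral>x. \<bar>?F j x\<bar> \<partial>lebesgue) = (\<integral>x. ?F j x \<partial>lebesgue)"
    proof (rule integral_cong_AE)
      show "AE x in lebesgue. \<bar>?F j x\<bar> = ?F j x"
        using enn[of j] by eventually_elim (simp add: d(2))
    qed (use d(1)[of j] e[of j] in auto)
    then show ?thesis using d(1) e by simp
  qed
  then have "(\<lambda>j. \<integral>x. \<bar>?F j x\<bar> \<partial>lebesgue) \<longlonglongrightarrow> 0"
    using tendsto_add[OF d(3) e0] by simp
  then obtain r H where r: "strict_mono r" "integrable lebesgue H"
    "AE x in lebesgue. (\<lambda>j. ?F (r j) x) \<longlonglongrightarrow> 0" "AE x in lebesgue. \<forall>j. \<bar>?F (r j) x\<bar> \<le> H x"
    using d(1) e by (elim L1_rapid_subsequence[rotated]) auto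
  show ?thesis
  proof (rule that[OF r(1,2)])
    show "AE x in lebesgue. (\<lambda>j. us (r j) x) \<longlonglongrightarrow> u x"
      using r(3) V1
    proof eventually_elim
      case (elim x)
      have "(\<lambda>j. \<bar>T 1 (us (r j) x - u x)\<bar> powr p) \<longlonglongrightarrow> 0"
      proof (rule tendsto_sandwich[OF _ _ tendsto_const elim(1)])
        have "\<bar>T 1 (us (r j) x - u x)\<bar> powr p \<le> ?F (r j) x" for j
          using mult_right_mono[OF elim(2), of "\<bar>T 1 (us (r j) x - u x)\<bar> powr p"] d(2)[of "r j" x] by simp
        then show "\<forall>\<^sub>F j in sequentially. \<bar>T 1 (us (r j) x - u x)\<bar> powr p \<le> ?F (r j) x" by simp
      qed simp
      then have "(\<lambda>j. (\<bar>T 1 (us (r j) x - u x)\<bar> powr p) powr (1 / p)) \<longlonglongrightarrow> 0 powr (1 / p)"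
        using p by (intro tendsto_powr') auto
      then have T0: "(\<lambda>j. \<bar>T 1 (us (r j) x - u x)\<bar>) \<longlonglongrightarrow> 0"
        using p by (simp add: powr_powr)
      \<comment> \<open>Once the truncated difference is below its level 1, the truncation is
        inactive and the difference itself tends to 0.\<close>
      then have "\<forall>\<^sub>F j in sequentially. \<bar>T 1 (us (r j) x - u x)\<bar> < 1"
        by (rule order_tendstoD) simp
      then have "\<forall>\<^sub>F j in sequentially. \<bar>T 1 (us (r j) x - u x)\<bar> = \<bar>us (r j) x - u x\<bar>"
        by eventually_elim (auto simp: T_def split: if_splits)
      then have "(\<lambda>j. \<bar>us (r j) x - u x\<bar>) \<longlonglongrightarrow> 0"
        using T0 by (simp cong: tendsto_cong)
      then show ?case
        by (simp add: tendsto_rabs_zero_iff LIM_zero_iff)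
    qed
    show "AE x in lebesgue. (\<lambda>j. d (r j) x) \<longlonglongrightarrow> 0"
      using r(3) V1
    proof eventually_elim
      case (elim x)
      show ?case
      proof (rule tendsto_sandwich[OF _ _ tendsto_const elim(1)])
        show "\<forall>\<^sub>F j in sequentially. d (r j) x \<le> ?F (r j) x" using elim(2) by simp
      qed (simp add: d(2))
    qed
    show "AE x in lebesgue. \<forall>j. d (r j) x \<le> H x"
      using r(4) V1
    proof eventually_elim
      case (elim x)
      show ?case
      proof
        fix j
        have "0 \<le> ?e (r j) x" using elim(2) by simp
        then show "d (r j) x \<le> H x" using elim(1)[rule_format, of j] by linarith
      qed
    qed
  qed
qed

subsection \<open>Passage to the limit\<close>

lemma HH_grad_tendsto:
  assumes v: "(\<lambda>j. v j x) \<longlonglongrightarrow> u x" and G: "(\<lambda>j. G j x) \<longlonglongrightarrow> G' x"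
    and "\<bar>T \<alpha> (u x) - \<phi> x\<bar> = t \<Longrightarrow> G' x - \<Phi> x = 0" "\<bar>T \<alpha> (u x)\<bar> = t \<Longrightarrow> G' x = 0"
  shows "(\<lambda>j. HH_grad \<alpha> t (v j) (G j) \<phi> \<Phi> x) \<longlonglongrightarrow> HH_grad \<alpha> t u G' \<phi> \<Phi> x"
  unfolding HH_grad_def
  by (intro tendsto_diff cutoff_tendsto T_tendsto tendsto_const v G assms(3,4))

lemma HH_tendsto:
  assumes "(\<lambda>j. v j x) \<longlonglongrightarrow> u x"
  shows "(\<lambda>j. HH \<alpha> t (v j) \<phi> x) \<longlonglongrightarrow> HH \<alpha> t u \<phi> x"
  unfolding HH_def by (intro tendsto_diff T_tendsto tendsto_const assms)

lemma AE_abs_level_set: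
  fixes G :: "'a::euclidean_space \<Rightarrow> 'a"
  assumes "is_weak_grad w G"
  shows "AE x in lebesgue. \<bar>w x\<bar> = t \<longrightarrow> G x = 0"
  using is_weak_grad_level_set[OF assms, of t] is_weak_grad_level_set[OF assms, of "- t"]
  by eventually_elim (auto simp: abs_if split: if_splits)

text \<open>Convergence of the gradients is available on \<open>K\<close> only. Off \<open>K\<close>
  both \<open>\<phi>\<close> and, by the level set property, \<open>\<Phi>\<close> vanish almost
  everywhere, so the integrands are zero there whatever \<open>G j\<close> does.\<close>

lemma flux_integral_tendsto:
  fixes G :: "nat \<Rightarrow> 'a::euclidean_space \<Rightarrow> 'a" and \<phi> u :: "'a \<Rightarrow> real"
  assumes p: "p \<ge> 2" and t: "t > 0"
    and G: "\<And>j. is_weak_grad (\<lambda>x. T \<alpha> (v j x)) (G j)"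
    and G': "is_weak_grad (\<lambda>x. T \<alpha> (u x)) G'" "integrable lebesgue (\<lambda>x. norm (G' x) powr p)"
    and \<Phi>: "is_weak_grad \<phi> \<Phi>" "integrable lebesgue (\<lambda>x. norm (\<Phi> x) powr p)"
    and \<phi>: "AE x in lebesgue. x \<notin> K \<longrightarrow> \<phi> x = 0"
    and v: "AE x in lebesgue. (\<lambda>j. v j x) \<longlonglongrightarrow> u x"
    and lim: "AE x in lebesgue. (\<lambda>j. indicator K x * norm (G j x - G' x) powr p) \<longlonglongrightarrow> 0"
    and dom: "AE x in lebesgue. \<forall>j. indicator K x * norm (G j x - G' x) powr p \<le> H x"
    and H: "integrable lebesgue H"
  shows "(\<lambda>j. \<integral>x. norm (G j x) powr (p - 2) * (G j x \<bullet> HH_grad \<alpha> t (v j) (G j) \<phi> \<Phi> x) \<partial>lebesgue)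
    \<longlonglongrightarrow> (\<integral>x. norm (G' x) powr (p - 2) * (G' x \<bullet> HH_grad \<alpha> t u G' \<phi> \<Phi> x) \<partial>lebesgue)"
proof -
  let ?D = "\<lambda>j. HH_grad \<alpha> t (v j) (G j) \<phi> \<Phi>" and ?D' = "HH_grad \<alpha> t u G' \<phi> \<Phi>"
  note gm = is_weak_grad_measurable
  note [measurable] = gm[OF G] gm[OF G'(1)] gm[OF is_weak_grad_HH[OF G \<Phi>(1) t]] gm[OF is_weak_grad_HH[OF G'(1) \<Phi>(1) t]]
  have \<Phi>0: "AE x in lebesgue. x \<notin> K \<longrightarrow> \<phi> x = 0 \<and> \<Phi> x = 0"
    using \<phi> is_weak_grad_level_set[OF \<Phi>(1), of 0] by eventually_elim blast
  \<comment> \<open>Of the three copies of \<open>G\<close>, one comes from the flux and two from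
    the bound on \<open>HH_grad\<close>. Replacing \<open>G j\<close> by \<open>G'\<close> leaves
    \<open>3 * norm (G j x - G' x)\<close>, which \<open>H\<close> controls.\<close>
  let ?B = "\<lambda>x. 3 * norm (G' x) + norm (\<Phi> x)"
  have intB: "integrable lebesgue (\<lambda>x. ?B x powr p)"
  proof (rule integrable_powr_add)
    show "integrable lebesgue (\<lambda>x. (3 * norm (G' x)) powr p)" using G'(2) by (simp add: powr_mult)
  qed (use gm[OF G'(1)] gm[OF \<Phi>(1)] \<Phi>(2) p in auto)
  show ?thesis
  proof (rule integral_dominated_convergence[where w = "\<lambda>x. 2 powr p * (3 powr p * H x + ?B x powr p)"])
    show "integrable lebesgue (\<lambda>x. 2 powr p * (3 powr p * H x + ?B x powr p))"
      using H intB by simp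
    show "AE x in lebesgue. (\<lambda>j. norm (G j x) powr (p - 2) * (G j x \<bullet> ?D j x))
        \<longlonglongrightarrow> norm (G' x) powr (p - 2) * (G' x \<bullet> ?D' x)"
      using \<Phi>0 v lim AE_abs_level_set[OF is_weak_grad_diff[OF G'(1) \<Phi>(1)], of t] AE_abs_level_set[OF G'(1), of t]
    proof eventually_elim
      case (elim x)
      show ?case
      proof (cases "x \<in> K")
        case True
        have "(\<lambda>j. (norm (G j x - G' x) powr p) powr (1 / p)) \<longlonglongrightarrow> 0 powr (1 / p)"
          using elim(3) True p by (intro tendsto_powr') auto
        then have "(\<lambda>j. norm (G j x - G' x)) \<longlonglongrightarrow> 0"
          using p by (simp add: powr_powr)
        then have Gx: "(\<lambda>j. G j x) \<longlonglongrightarrow> G' x"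
          by (simp add: tendsto_norm_zero_iff LIM_zero_iff)
        then have "(\<lambda>j. ?D j x) \<longlonglongrightarrow> ?D' x"
          using elim by (intro HH_grad_tendsto) auto
        then show ?thesis
          by (rule p_flux_tendsto[OF p Gx])
      next
        case False
        then show ?thesis using elim(1) by (simp add: HH_grad_outside)
      qed
    qed
    show "AE x in lebesgue. norm (norm (G j x) powr (p - 2) * (G j x \<bullet> ?D j x))
        \<le> 2 powr p * (3 powr p * H x + ?B x powr p)" for j
      using \<Phi>0 dom
    proof eventually_elim
      case (elim x)
      show ?case
      proof (cases "x \<in> K")
        case True
        let ?d = "norm (G j x - G' x)"
        have "norm (norm (G j x) powr (p - 2) * (G j x \<bullet> ?D j x)) \<le> (norm (G j x) + norm (?D j x)) powr p"
          using p_flux_bound[OF p, of "G j x" "?D j x"] by simp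
        also have "\<dots> \<le> (3 * ?d + ?B x) powr p"
          using norm_HH_grad_le[of \<alpha> t "v j" "G j" \<phi> \<Phi> x] norm_triangle_ineq2[of "G j x" "G' x"] p
          by (intro powr_mono2) auto
        also have "\<dots> \<le> 2 powr p * ((3 * ?d) powr p + ?B x powr p)"
          using p by (intro powr_add_le) auto
        also have "\<dots> \<le> 2 powr p * (3 powr p * H x + ?B x powr p)"
          using elim(2)[rule_format, of j] True by (intro mult_left_mono add_right_mono) (auto simp: powr_mult)
        finally show ?thesis .
      next
        case False
        \<comment> \<open>\<open>H\<close> is known only as a majorant; off \<open>K\<close> the
          dominated term is 0, which yields its sign.\<close>
        have "0 \<le> H x"
          using elim(2)[rule_format, of j] False by simp
        then show ?thesis using elim(1) False by (simp add: HH_grad_outside)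
      qed
    qed
  qed measurable
qed

text \<open>Truncation, \<open>\<phi>\<close> and, on \<open>K\<close>, also \<open>V\<close> are
  bounded, so a constant on the compact set is a majorant and pointwise convergence
  suffices.\<close>

lemma potential_integral_tendsto:
  fixes V \<phi> u :: "'a::euclidean_space \<Rightarrow> real"
  assumes p: "p \<ge> 2" and \<alpha>: "\<alpha> > 0" and V: "Linf_loc V" and K: "compact K"
    and m: "\<And>j. v j \<in> borel_measurable lebesgue" "u \<in> borel_measurable lebesgue" "\<phi> \<in> borel_measurable lebesgue"
    and \<phi>: "AE x in lebesgue. x \<notin> K \<longrightarrow> \<phi> x = 0" "AE x in lebesgue. \<bar>\<phi> x\<bar> \<le> M"
    and v: "AE x in lebesgue. (\<lambda>j. v j x) \<longlonglongrightarrow> u x"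
  shows "(\<lambda>j. \<integral>x. \<bar>T \<alpha> (v j x)\<bar> powr (p - 2) * (T \<alpha> (v j x) * HH \<alpha> t (v j) \<phi> x) * V x \<partial>lebesgue)
    \<longlonglongrightarrow> (\<integral>x. \<bar>T \<alpha> (u x)\<bar> powr (p - 2) * (T \<alpha> (u x) * HH \<alpha> t u \<phi> x) * V x \<partial>lebesgue)"
proof -
  obtain C where C: "AE x in lebesgue. x \<in> K \<longrightarrow> \<bar>V x\<bar> \<le> C"
    using V K by (auto simp: Linf_loc_def)
  have [measurable]: "V \<in> borel_measurable lebesgue" using V by (simp add: Linf_loc_def)
  note [measurable] = HH_measurable[OF m(1) m(3)] HH_measurable[OF m(2) m(3)] T_measurable[OF m(1)] T_measurable[OF m(2)]
  show ?thesis
  proof (rule integral_dominated_convergence[where w = "\<lambda>x. indicator K x * ((\<alpha> + M) powr p * C)"])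
    have "integrable lebesgue (indicator K :: 'a \<Rightarrow> real)"
      using lmeasurable_compact[OF K] by (auto simp: fmeasurable_def)
    then show "integrable lebesgue (\<lambda>x. indicator K x * ((\<alpha> + M) powr p * C))" by simp
    show "AE x in lebesgue. (\<lambda>j. \<bar>T \<alpha> (v j x)\<bar> powr (p - 2) * (T \<alpha> (v j x) * HH \<alpha> t (v j) \<phi> x) * V x)
        \<longlonglongrightarrow> \<bar>T \<alpha> (u x)\<bar> powr (p - 2) * (T \<alpha> (u x) * HH \<alpha> t u \<phi> x) * V x"
      using v
    proof eventually_elim
      case (elim x)
      show ?case
        using tendsto_mult_right[OF p_flux_tendsto[OF p T_tendsto[OF elim] HH_tendsto[of v x u, OF elim]]]
        by simp
    qed
    show "AE x in lebesgue. norm (\<bar>T \<alpha> (v j x)\<bar> powr (p - 2) * (T \<alpha> (v j x) * HH \<alpha> t (v j) \<phi> x) * V x)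
        \<le> indicator K x * ((\<alpha> + M) powr p * C)" for j
      using C \<phi>
    proof eventually_elim
      case (elim x)
      let ?q = "\<bar>T \<alpha> (v j x)\<bar> powr (p - 2) * (T \<alpha> (v j x) * HH \<alpha> t (v j) \<phi> x)"
      show ?case
      proof (cases "x \<in> K")
        case True
        have "\<bar>?q\<bar> \<le> (\<bar>T \<alpha> (v j x)\<bar> + \<bar>HH \<alpha> t (v j) \<phi> x\<bar>) powr p"
          using p_flux_bound[OF p, of "T \<alpha> (v j x)" "HH \<alpha> t (v j) \<phi> x"] by simp
        also have "\<dots> \<le> (\<alpha> + M) powr p"
          using T_bound[OF \<alpha>, of "v j x"] HH_abs_le[of \<alpha> t "v j" \<phi> x] elim(3) p
          by (intro powr_mono2) auto
        finally have "\<bar>?q\<bar> * \<bar>V x\<bar> \<le> (\<alpha> + M) powr p * C"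
          using elim(1) True by (intro mult_mono) auto
        then show ?thesis using True by (simp add: abs_mult)
      next
        case False
        then have "HH \<alpha> t (v j) \<phi> x = 0" using elim(2) HH_abs_le[of \<alpha> t "v j" \<phi> x] by simp
        then show ?thesis using False by simp
      qed
    qed
  qed measurable
qed

text \<open>The data converge in the mean, not pointwise. Splitting \<open>g j\<close> into
  \<open>(g j - f) + f\<close> leaves one term bounded by \<open>\<bar>M\<bar>\<close> times the L1
  error and one with fixed weight \<open>f\<close>, to which dominated convergence applies.\<close>

lemma datum_integral_tendsto:
  fixes f \<phi> u :: "'a::euclidean_space \<Rightarrow> real"
  assumes g: "\<And>j. integrable lebesgue (g j)" and f: "integrable lebesgue f"
    and lim: "(\<lambda>j. \<integral>x. \<bar>g j x - f x\<bar> \<partial>lebesgue) \<longlonglongrightarrow> 0"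
    and m: "\<And>j. v j \<in> borel_measurable lebesgue" "u \<in> borel_measurable lebesgue" "\<phi> \<in> borel_measurable lebesgue"
    and \<phi>: "AE x in lebesgue. \<bar>\<phi> x\<bar> \<le> M"
    and v: "AE x in lebesgue. (\<lambda>j. v j x) \<longlonglongrightarrow> u x"
  shows "(\<lambda>j. \<integral>x. g j x * HH \<alpha> t (v j) \<phi> x \<partial>lebesgue) \<longlonglongrightarrow> (\<integral>x. f x * HH \<alpha> t u \<phi> x \<partial>lebesgue)"
proof -
  note Hm = HH_measurable[OF m(1) m(3), of \<alpha> t] HH_measurable[OF m(2) m(3), of \<alpha> t]
  note [measurable] = Hm borel_measurable_integrable[OF f] borel_measurable_integrable[OF g]
  have bd: "AE x in lebesgue. norm (q x * HH \<alpha> t w \<phi> x) \<le> \<bar>M\<bar> * \<bar>q x\<bar>" for q w :: "'a \<Rightarrow> real"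
    using \<phi>
  proof eventually_elim
    case (elim x)
    have "\<bar>HH \<alpha> t w \<phi> x\<bar> \<le> \<bar>M\<bar>" using elim HH_abs_le[of \<alpha> t w \<phi> x] by linarith
    from mult_left_mono[OF this, of "\<bar>q x\<bar>"] show ?case by (simp add: abs_mult mult.commute)
  qed
  have int: "integrable lebesgue (\<lambda>x. q x * HH \<alpha> t (v j) \<phi> x)" if q: "integrable lebesgue q" for q j
  proof (rule Bochner_Integration.integrable_bound)
    show "integrable lebesgue (\<lambda>x. \<bar>M\<bar> * \<bar>q x\<bar>)" using q by simp
    show "(\<lambda>x. q x * HH \<alpha> t (v j) \<phi> x) \<in> borel_measurable lebesgue"
      using borel_measurable_integrable[OF q] by measurable
    show "AE x in lebesgue. norm (q x * HH \<alpha> t (v j) \<phi> x) \<le> norm (\<bar>M\<bar> * \<bar>q x\<bar>)"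
      using bd by (simp add: abs_mult)
  qed
  have 1: "(\<lambda>j. \<integral>x. f x * HH \<alpha> t (v j) \<phi> x \<partial>lebesgue) \<longlonglongrightarrow> (\<integral>x. f x * HH \<alpha> t u \<phi> x \<partial>lebesgue)"
  proof (rule integral_dominated_convergence[where w = "\<lambda>x. \<bar>M\<bar> * \<bar>f x\<bar>"])
    show "AE x in lebesgue. (\<lambda>j. f x * HH \<alpha> t (v j) \<phi> x) \<longlonglongrightarrow> f x * HH \<alpha> t u \<phi> x"
      using v by eventually_elim (intro tendsto_mult tendsto_const HH_tendsto)
  qed (use f bd in auto)
  have 2: "(\<lambda>j. \<integral>x. (g j x - f x) * HH \<alpha> t (v j) \<phi> x \<partial>lebesgue) \<longlonglongrightarrow> 0"
  proof (rule Lim_null_comparison)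
    have "norm (\<integral>x. (g j x - f x) * HH \<alpha> t (v j) \<phi> x \<partial>lebesgue) \<le> \<bar>M\<bar> * (\<integral>x. \<bar>g j x - f x\<bar> \<partial>lebesgue)" for j
    proof -
      have i: "integrable lebesgue (\<lambda>x. g j x - f x)" using g f by simp
      have "norm (\<integral>x. (g j x - f x) * HH \<alpha> t (v j) \<phi> x \<partial>lebesgue)
          \<le> (\<integral>x. norm ((g j x - f x) * HH \<alpha> t (v j) \<phi> x) \<partial>lebesgue)"
        by (rule integral_norm_bound)
      also have "\<dots> \<le> (\<integral>x. \<bar>M\<bar> * \<bar>g j x - f x\<bar> \<partial>lebesgue)"
        using i int[OF i] bd by (intro integral_mono_AE integrable_norm) auto
      finally show ?thesis by simp
    qed
    then show "\<forall>\<^sub>F j in sequentially. norm (\<integral>x. (g j x - f x) * HH \<alpha> t (v j) \<phi> x \<partial>lebesgue)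
        \<le> \<bar>M\<bar> * (\<integral>x. \<bar>g j x - f x\<bar> \<partial>lebesgue)" by simp
    show "(\<lambda>j. \<bar>M\<bar> * (\<integral>x. \<bar>g j x - f x\<bar> \<partial>lebesgue)) \<longlonglongrightarrow> 0"
      using tendsto_mult_left[OF lim, of "\<bar>M\<bar>"] by simp
  qed
  have "(\<integral>x. g j x * HH \<alpha> t (v j) \<phi> x \<partial>lebesgue)
      = (\<integral>x. (g j x - f x) * HH \<alpha> t (v j) \<phi> x \<partial>lebesgue) + (\<integral>x. f x * HH \<alpha> t (v j) \<phi> x \<partial>lebesgue)" for j
    using int[OF g] int[OF f] by (simp add: left_diff_distrib)
  then show ?thesis using tendsto_add[OF 2 1] by simp
qed

theorem theorem7p3:
  fixes V f u :: "'a::euclidean_space \<Rightarrow> real" and p :: real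
    and us fs :: "nat \<Rightarrow> 'a \<Rightarrow> real"
  assumes "p \<ge> 2"
    and "Linf_loc V" and "AE x in lebesgue. V x \<ge> 1"
    and "integrable lebesgue f"
    and "asymptotic_energy_sol V p f u"
    and "approx_seq V p f u us fs"
    and "\<forall>\<alpha>>0. \<forall>K. compact K \<longrightarrow>
           (\<lambda>j. \<integral>x. indicator K x * norm (wgrad (\<lambda>y. T \<alpha> (us j y)) x - wgrad (\<lambda>y. T \<alpha> (u y)) x) powr p
                 \<partial>lebesgue) \<longlonglongrightarrow> 0"
  shows "localized_asymptotic_sol V p f u"
proof -
  note p = assms(1) and V = assms(2) and V1 = assms(3) and f = assms(4) and ap = assms(6)
  have u: "Lambda_p p u" "\<forall>\<alpha>>0. inX V p (\<lambda>x. T \<alpha> (u x))"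
    using assms(5) by (auto simp: asymptotic_energy_sol_def)
  have p0: "p > 0" using p by simp
  have um: "u \<in> borel_measurable lebesgue" using u(1) by (simp add: Lambda_p_def)
  have sol: "weak_energy_sol V p (fs j) (us j)" for j
    using ap by (simp add: approx_seq_def)
  have usW: "W1p p (us j)" for j
    using sol[of j] by (simp add: weak_energy_sol_def inX_def)
  have "(\<integral>x. norm (wgrad (\<lambda>y. T \<alpha> (u y)) x) powr (p - 2) *
          (wgrad (\<lambda>y. T \<alpha> (u y)) x \<bullet> wgrad (HH \<alpha> t u \<phi>) x) \<partial>lebesgue)
      + (\<integral>x. V x * \<bar>T \<alpha> (u x)\<bar> powr (p - 2) * T \<alpha> (u x) * HH \<alpha> t u \<phi> x \<partial>lebesgue)
      = (\<integral>x. f x * HH \<alpha> t u \<phi> x \<partial>lebesgue)"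
    if t: "t > 0" and \<phi>: "W1p p \<phi>" and K: "compact K" "AE x in lebesgue. x \<notin> K \<longrightarrow> \<phi> x = 0"
      and \<alpha>: "ereal \<alpha> > ereal t + Linf_norm \<phi>"
    for t \<alpha> and \<phi> :: "'a \<Rightarrow> real" and K
  proof -
    have small: "AE x in lebesgue. \<bar>\<phi> x\<bar> < \<alpha> - t"
      using esssup_AE[of "\<lambda>x. ereal \<bar>\<phi> x\<bar>" lebesgue]
    proof eventually_elim
      case (elim x)
      then have "ereal t + ereal \<bar>\<phi> x\<bar> \<le> ereal t + Linf_norm \<phi>"
        unfolding Linf_norm_def by (rule add_left_mono)
      then have "ereal t + ereal \<bar>\<phi> x\<bar> < ereal \<alpha>" using \<alpha> by (rule le_less_trans)
      then show ?case by simp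
    qed
    \<comment> \<open>A property that holds almost everywhere holds somewhere, Lebesgue measure
      being nonzero. One such point gives \<open>\<alpha> > t\<close>, hence
      \<open>\<alpha> > 0\<close>.\<close>
    have "\<exists>x. \<bar>\<phi> x\<bar> < \<alpha> - t"
    proof (rule ccontr)
      assume "\<not> ?thesis"
      then have "AE x in (lebesgue :: 'a measure). False" using small by (simp add: eventually_mono)
      then show False by (simp add: ae_filter_eq_bot_iff trivial_limit_def[symmetric] eventually_False)
    qed
    then have \<alpha>0: "\<alpha> > 0" using t by auto
    let ?G = "\<lambda>j. wgrad (\<lambda>y. T \<alpha> (us j y))" and ?G' = "wgrad (\<lambda>y. T \<alpha> (u y))"
    have TW: "W1p p (\<lambda>x. T \<alpha> (us j x))" for j by (rule W1p_truncation[OF usW \<alpha>0 p0])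
    have TU: "W1p p (\<lambda>x. T \<alpha> (u x))" using u(2) \<alpha>0 by (simp add: inX_def)
    note G = W1p_wgrad[OF TW] and G' = W1p_wgrad[OF TU] and F = W1p_wgrad[OF \<phi>]
    \<comment> \<open>The local gradient error takes the part of the additional error in the choice
      of the subsequence.\<close>
    let ?d = "\<lambda>j x. indicator K x * norm (?G j x - ?G' x) powr p"
    have Ks: "K \<in> sets lebesgue" using lmeasurable_compact[OF K(1)] by (rule fmeasurableD)
    have "integrable lebesgue (?d j)" for j
    proof -
      have "integrable lebesgue (\<lambda>x. (norm (?G j x) + norm (?G' x)) powr p)"
        using G G' p0 by (intro integrable_powr_add) auto
      then have "integrable lebesgue (\<lambda>x. norm (?G j x - ?G' x) powr p)"
        using G(4)[of j] G'(4) p0 by (rule_tac integrable_powr_bound) (auto intro: norm_triangle_ineq4)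
      from integrable_mult_indicator[OF Ks this] show ?thesis by simp
    qed
    moreover have "(\<lambda>j. \<integral>x. ?d j x \<partial>lebesgue) \<longlonglongrightarrow> 0"
      using assms(7) \<alpha>0 K(1) by blast
    ultimately obtain r H where r: "strict_mono r" "integrable lebesgue H"
      "AE x in lebesgue. (\<lambda>j. us (r j) x) \<longlonglongrightarrow> u x"
      "AE x in lebesgue. (\<lambda>j. ?d (r j) x) \<longlonglongrightarrow> 0" "AE x in lebesgue. \<forall>j. ?d (r j) x \<le> H x"
      by (elim approx_seq_subsequence[OF p0 V1 ap, rotated 2]) auto
    have usm: "us j \<in> borel_measurable lebesgue" for j by (rule W1p_wgrad(3)[OF usW])
    have \<phi>M: "AE x in lebesgue. \<bar>\<phi> x\<bar> \<le> \<alpha>"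
      using small by eventually_elim (use t in auto)
    have L1: "(\<lambda>j. \<integral>x. norm (?G (r j) x) powr (p - 2) * (?G (r j) x \<bullet> HH_grad \<alpha> t (us (r j)) (?G (r j)) \<phi> (wgrad \<phi>) x) \<partial>lebesgue)
        \<longlonglongrightarrow> (\<integral>x. norm (?G' x) powr (p - 2) * (?G' x \<bullet> HH_grad \<alpha> t u ?G' \<phi> (wgrad \<phi>) x) \<partial>lebesgue)"
      by (rule flux_integral_tendsto[OF p t G(1) G'(1,2) F(1,2) K(2) r(3,4,5,2)])
    have L2: "(\<lambda>j. \<integral>x. \<bar>T \<alpha> (us (r j) x)\<bar> powr (p - 2) * (T \<alpha> (us (r j) x) * HH \<alpha> t (us (r j)) \<phi> x) * V x \<partial>lebesgue)
        \<longlonglongrightarrow> (\<integral>x. \<bar>T \<alpha> (u x)\<bar> powr (p - 2) * (T \<alpha> (u x) * HH \<alpha> t u \<phi> x) * V x \<partial>lebesgue)"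
      by (rule potential_integral_tendsto[OF p \<alpha>0 V K(1) usm um F(3) K(2) \<phi>M r(3)])
    have L3: "(\<lambda>j. \<integral>x. fs (r j) x * HH \<alpha> t (us (r j)) \<phi> x \<partial>lebesgue) \<longlonglongrightarrow> (\<integral>x. f x * HH \<alpha> t u \<phi> x \<partial>lebesgue)"
    proof (rule datum_integral_tendsto[OF _ f _ usm um F(3) \<phi>M r(3)])
      show "integrable lebesgue (fs (r j))" for j using ap by (simp add: approx_seq_def)
      have "(\<lambda>j. \<integral>x. \<bar>fs j x - f x\<bar> \<partial>lebesgue) \<longlonglongrightarrow> 0" using ap by (simp add: approx_seq_def)
      from LIMSEQ_subseq_LIMSEQ[OF this r(1)]
      show "(\<lambda>j. \<integral>x. \<bar>fs (r j) x - f x\<bar> \<partial>lebesgue) \<longlonglongrightarrow> 0" by (simp add: comp_def)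
    qed
    note eq = weak_energy_sol_truncated[OF p0 V sol \<phi> K t small \<alpha>0]
    have lim: "(\<integral>x. norm (?G' x) powr (p - 2) * (?G' x \<bullet> HH_grad \<alpha> t u ?G' \<phi> (wgrad \<phi>) x) \<partial>lebesgue)
        + (\<integral>x. \<bar>T \<alpha> (u x)\<bar> powr (p - 2) * (T \<alpha> (u x) * HH \<alpha> t u \<phi> x) * V x \<partial>lebesgue)
        = (\<integral>x. f x * HH \<alpha> t u \<phi> x \<partial>lebesgue)"
      by (rule LIMSEQ_unique[OF tendsto_add[OF L1 L2, unfolded eq] L3])
    \<comment> \<open>The limit equation is stated with the explicit gradient; uniqueness now
      exchanges it for the chosen \<open>wgrad\<close> of the definition.\<close>
    have g: "is_weak_grad (HH \<alpha> t u \<phi>) (HH_grad \<alpha> t u ?G' \<phi> (wgrad \<phi>))"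
      by (intro is_weak_grad_HH G' F t)
    note [measurable] = G'(4) is_weak_grad_measurable[OF g] is_weak_grad_measurable[OF is_weak_grad_wgrad[OF g]]
    have "(\<integral>x. norm (?G' x) powr (p - 2) * (?G' x \<bullet> wgrad (HH \<alpha> t u \<phi>) x) \<partial>lebesgue)
        = (\<integral>x. norm (?G' x) powr (p - 2) * (?G' x \<bullet> HH_grad \<alpha> t u ?G' \<phi> (wgrad \<phi>) x) \<partial>lebesgue)"
    proof (rule integral_cong_AE)
      show "AE x in lebesgue. norm (?G' x) powr (p - 2) * (?G' x \<bullet> wgrad (HH \<alpha> t u \<phi>) x)
          = norm (?G' x) powr (p - 2) * (?G' x \<bullet> HH_grad \<alpha> t u ?G' \<phi> (wgrad \<phi>) x)"
        using wgrad_eq_AE[OF g] by eventually_elim simp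
    qed measurable
    moreover have "(\<integral>x. V x * \<bar>T \<alpha> (u x)\<bar> powr (p - 2) * T \<alpha> (u x) * HH \<alpha> t u \<phi> x \<partial>lebesgue)
        = (\<integral>x. \<bar>T \<alpha> (u x)\<bar> powr (p - 2) * (T \<alpha> (u x) * HH \<alpha> t u \<phi> x) * V x \<partial>lebesgue)"
      by (intro Bochner_Integration.integral_cong) (auto simp: mult_ac)
    ultimately show ?thesis using lim by simp
  qed
  then show ?thesis
    using u unfolding localized_asymptotic_sol_def by blast
qed

end
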